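(* Consider Cantor space $2^{\mathbb N}$ with the Lebesgue measure $\lambda$. Let $x\in 2^{\mathbb N}$ be neither Schnorr random nor weakly 1-generic. Then there are a $\Pi^0_1$ set $A\ni x$ such that $\lambda(A)>0$ and $\lambda(A)$ is computable, and a total computable measure-preserving transformation $T:2^{\mathbb N}\to 2^{\mathbb N}$, such that $T^k(x)\notin A$ for all $k>0$.
   Context: Uniformity: a sequence of objects has a property (whose definition involves an index in $\mathbb N$) uniformly if a computable function produces suitable indices. For a finite binary string $\sigma$, $[\![\sigma]\!]=\{x\in 2^{\mathbb N}:\sigma\text{ is an initial segment of }x\}$; these cylinders are the basic open sets of Cantor space. The Lebesgue measure $\lambda$ is the Borel probability measure with $\lambda[\![\sigma]\!]=2^{-|\sigma|}$. A set is $\Sigma^0_1$ if it is $\bigcup_{\sigma\in W}[\![\sigma]\!]$ for a c.e. set $W$ of strings, and $\Pi^0_1$ if its complement is $\Sigma^0_1$. A Schnorr test is a sequence $(U_k)_k$ of uniformly $\Sigma^0_1$ sets with $\lambda(U_k)\le 2^{-k}$ for all $k$ and $\lambda(U_k)$ uniformly computable in $k$. A point $x$ is Schnorr random if $x\notin\bigcap_kU_k$ for every Schnorr test. A point is weakly 1-generic if it lies in every dense $\Sigma^0_1$ set. A total map $T:2^{\mathbb N}\to2^{\mathbb N}$ is computable if the sets $T^{-1}[\![\sigma]\!]$ are $\Sigma^0_1$ uniformly in $\sigma$, and is a measure-preserving transformation if $\lambda(T^{-1}(B))=\lambda(B)$ for every Borel set $B$. *)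

theory Defs
  imports "HOL-Probability.Probability" "HOL-Library.Nat_Bijection"
begin

text \<open>
  Terms for the partial recursive functions on the natural numbers.  All functions are unary;
  several arguments are combined by the Cantor pairing function \<^const>\<open>prod_encode\<close>.
  \<open>eval f n m\<close> means that \<open>f\<close> is defined at \<open>n\<close> with value \<open>m\<close>.
\<close>

datatype recf =
    ZeroF | SuccF | FstF | SndF
  | PairF recf recf
  | CompF recf recf
  | PrecF recf recf
  | MinF recf

inductive eval :: "recf \<Rightarrow> nat \<Rightarrow> nat \<Rightarrow> bool" where
  zero: "eval ZeroF n 0"
| succ: "eval SuccF n (Suc n)"
| fst: "eval FstF n (fst (prod_decode n))"
| snd: "eval SndF n (snd (prod_decode n))"
| pair: "eval f n a \<Longrightarrow> eval g n b \<Longrightarrow> eval (PairF f g) n (prod_encode (a, b))"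
| comp: "eval g n a \<Longrightarrow> eval f a b \<Longrightarrow> eval (CompF f g) n b"
| prec_0: "eval f a b \<Longrightarrow> eval (PrecF f g) (prod_encode (a, 0)) b"
| prec_Suc: "eval (PrecF f g) (prod_encode (a, m)) r \<Longrightarrow>
    eval g (prod_encode (a, prod_encode (m, r))) b \<Longrightarrow>
    eval (PrecF f g) (prod_encode (a, Suc m)) b"
| min: "eval f (prod_encode (a, m)) 0 \<Longrightarrow>
    (\<forall>i<m. \<exists>y. eval f (prod_encode (a, i)) (Suc y)) \<Longrightarrow> eval (MinF f) a m"

inductive_cases eval_elims:
  "eval ZeroF n c" "eval SuccF n c" "eval FstF n c" "eval SndF n c" "eval (PairF f g) n c"
  "eval (CompF f g) n c" "eval (PrecF f g) (prod_encode (a, 0)) c"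
  "eval (PrecF f g) (prod_encode (a, Suc m)) c" "eval (MinF f) a c"

lemma eval_det: "eval f n a \<Longrightarrow> eval f n b \<Longrightarrow> a = b"
proof (induction arbitrary: b rule: eval.induct)
  case (pair f n a g c)
  from pair.prems show ?case
    by (rule eval_elims(5)) (use pair.IH in blast)
next
  case (comp g n a f c)
  from comp.prems show ?case
    by (rule eval_elims(6)) (use comp.IH in blast)
next
  case (prec_0 f a b g c)
  from prec_0.prems show ?case
    by (rule eval_elims(7)) (use prec_0.IH in auto)
next
  case (prec_Suc f g a m r b c)
  from prec_Suc.prems obtain r' where
    "eval (PrecF f g) (prod_encode (a, m)) r'" "eval g (prod_encode (a, prod_encode (m, r'))) c"
    by (rule eval_elims(8)) auto
  then show ?case using prec_Suc.IH by blast
next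
  case (min f a m)
  from min.prems have b: "eval f (prod_encode (a, b)) 0"
    and less: "\<forall>i<b. \<exists>y. eval f (prod_encode (a, i)) (Suc y)"
    by (auto elim: eval_elims(9))
  show ?case
  proof (rule linorder_cases[of m b])
    assume "m < b"
    then obtain y where "eval f (prod_encode (a, m)) (Suc y)" using less by blast
    then show ?thesis using min.IH(1) by blast
  next
    assume "b < m"
    then obtain y where "\<And>c. eval f (prod_encode (a, b)) c \<Longrightarrow> Suc y = c"
      using min.IH(2) by blast
    then show ?thesis using b by blast
  qed
qed (auto elim: eval_elims(1-4))

fun goedel :: "recf \<Rightarrow> nat" where
  "goedel ZeroF = prod_encode (0, 0)"
| "goedel SuccF = prod_encode (1, 0)"
| "goedel FstF = prod_encode (2, 0)"
| "goedel SndF = prod_encode (3, 0)"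
| "goedel (PairF f g) = prod_encode (4, prod_encode (goedel f, goedel g))"
| "goedel (CompF f g) = prod_encode (5, prod_encode (goedel f, goedel g))"
| "goedel (PrecF f g) = prod_encode (6, prod_encode (goedel f, goedel g))"
| "goedel (MinF f) = prod_encode (7, goedel f)"

lemma goedel_inject: "goedel f = goedel g \<longleftrightarrow> f = g"
proof
  show "goedel f = goedel g \<Longrightarrow> f = g"
    by (induction f arbitrary: g) (case_tac g; simp)+
qed simp

text \<open>
  \<open>phi e n m\<close> means that the \<open>e\<close>-th partial computable function maps \<open>n\<close> to \<open>m\<close>.  A number
  that is not the code of a term is an index of the nowhere defined function.
\<close>

definition phi :: "nat \<Rightarrow> nat \<Rightarrow> nat \<Rightarrow> bool" where
  "phi e n m \<longleftrightarrow> (\<exists>f. goedel f = e \<and> eval f n m)"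

definition W :: "nat \<Rightarrow> nat set" where
  "W e = {n. \<exists>m. phi e n m}"

definition computable :: "(nat \<Rightarrow> nat) \<Rightarrow> bool" where
  "computable f \<longleftrightarrow> (\<exists>e. \<forall>n. phi e n (f n))"

text \<open>\<open>rat_of_code\<close> is onto the rationals (as a subset of the reals).\<close>

definition rat_of_code :: "nat \<Rightarrow> real" where
  "rat_of_code q = (case prod_decode q of (a, d) \<Rightarrow> of_int (int_decode a) / of_nat (Suc d))"

definition real_index :: "nat \<Rightarrow> real \<Rightarrow> bool" where
  "real_index e r \<longleftrightarrow> (\<forall>n. \<exists>q. phi e n q \<and> \<bar>rat_of_code q - r\<bar> \<le> (1/2) ^ n)"

definition computable_real :: "real \<Rightarrow> bool" where
  "computable_real r \<longleftrightarrow> (\<exists>e. real_index e r)"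

text \<open>
  Uniformity, here and below, is expressed by a computable function that produces indices.
\<close>

definition uniformly_computable_reals :: "(nat \<Rightarrow> real) \<Rightarrow> bool" where
  "uniformly_computable_reals r \<longleftrightarrow> (\<exists>f. computable f \<and> (\<forall>k. real_index (f k) (r k)))"

text \<open>
  Points are functions \<^typ>\<open>nat \<Rightarrow> bool\<close>, with the library's product topology of the discrete
  topology on \<^typ>\<open>bool\<close>.
\<close>

type_synonym cantor = "nat \<Rightarrow> bool"

definition cylinder :: "bool list \<Rightarrow> cantor set" where
  "cylinder \<sigma> = {x. \<forall>i<length \<sigma>. x i = \<sigma> ! i}"

definition lam :: "cantor measure" where
  "lam = (\<Pi>\<^sub>M i\<in>UNIV. uniform_count_measure UNIV)"

lemma space_lam [simp]: "space lam = UNIV"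
  by (simp add: lam_def space_PiM space_uniform_count_measure)

instance bool :: second_countable_topology
proof
  have "open = generate_topology (UNIV :: bool set set)"
    by (intro ext) (simp add: discrete_topology_class.open_discrete generate_topology.Basis)
  then show "\<exists>B :: bool set set. countable B \<and> open = generate_topology B"
    by (intro exI[of _ UNIV]) simp
qed

lemma sets_borel_bool: "sets (borel :: bool measure) = UNIV"
  by (intro equalityI subsetI UNIV_I borel_open discrete_topology_class.open_discrete)

lemma sets_lam: "sets lam = sets borel"
proof -
  have "sets lam = sets (\<Pi>\<^sub>M i\<in>(UNIV :: nat set). (borel :: bool measure))"
    unfolding lam_def
    by (intro sets_PiM_cong) (simp_all add: sets_uniform_count_measure sets_borel_bool)
  then show ?thesis by (simp only: sets_PiM_equal_borel)
qed

lemma prob_space_lam: "prob_space lam"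
  unfolding lam_def
  by (intro prob_space_PiM prob_space_uniform_count_measure) simp_all

lemma measure_cylinder: "measure lam (cylinder \<sigma>) = (1/2) ^ length \<sigma>"
proof -
  let ?M = "\<lambda>i::nat. uniform_count_measure (UNIV :: bool set)"
  let ?J = "{..<length \<sigma>}"
  interpret product_prob_space ?M UNIV
    by (intro product_prob_spaceI prob_space_uniform_count_measure) simp_all
  have "emeasure lam (cylinder \<sigma>) =
      emeasure (Pi\<^sub>M UNIV ?M) {x \<in> space (Pi\<^sub>M UNIV ?M). \<forall>i\<in>?J. x i \<in> {\<sigma> ! i}}"
    by (simp add: lam_def cylinder_def space_PiM space_uniform_count_measure lessThan_iff Ball_def)
  also have "\<dots> = (\<Prod>i\<in>?J. emeasure (?M i) {\<sigma> ! i})"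
    by (rule emeasure_PiM_Collect) (simp_all add: sets_uniform_count_measure)
  also have "\<dots> = (\<Prod>i\<in>?J. ennreal (1/2))"
    by (rule prod.cong) (simp_all add: emeasure_uniform_count_measure UNIV_bool)
  also have "\<dots> = ennreal ((1/2) ^ length \<sigma>)"
    by (simp only: prod_constant card_lessThan ennreal_power)
  finally show ?thesis
    by (simp only: measure_def enn2real_ennreal zero_le_power zero_le_divide_1_iff zero_le_numeral)
qed

text \<open>
  A set of strings is c.e. if and only if it is \<open>{\<sigma>. str_code \<sigma> \<in> W e}\<close> for some \<open>e\<close>; the
  numbers in \<open>W e\<close> that code no string are ignored.
\<close>

definition str_code :: "bool list \<Rightarrow> nat" where
  "str_code \<sigma> = list_encode (map of_bool \<sigma>)"

definition Sigma01_set :: "nat \<Rightarrow> cantor set" where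
  "Sigma01_set e = (\<Union>\<sigma>\<in>{\<sigma>. str_code \<sigma> \<in> W e}. cylinder \<sigma>)"

definition Sigma01 :: "cantor set \<Rightarrow> bool" where
  "Sigma01 S \<longleftrightarrow> (\<exists>e. S = Sigma01_set e)"

definition Pi01 :: "cantor set \<Rightarrow> bool" where
  "Pi01 S \<longleftrightarrow> Sigma01 (- S)"

definition uniformly_Sigma01 :: "(nat \<Rightarrow> cantor set) \<Rightarrow> bool" where
  "uniformly_Sigma01 U \<longleftrightarrow> (\<exists>f. computable f \<and> (\<forall>k. U k = Sigma01_set (f k)))"

definition schnorr_test :: "(nat \<Rightarrow> cantor set) \<Rightarrow> bool" where
  "schnorr_test U \<longleftrightarrow> uniformly_Sigma01 U \<and> (\<forall>k. measure lam (U k) \<le> (1/2) ^ k) \<and>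
     uniformly_computable_reals (\<lambda>k. measure lam (U k))"

definition schnorr_random :: "cantor \<Rightarrow> bool" where
  "schnorr_random x \<longleftrightarrow> (\<forall>U. schnorr_test U \<longrightarrow> x \<notin> (\<Inter>k. U k))"

definition weakly_1_generic :: "cantor \<Rightarrow> bool" where
  "weakly_1_generic x \<longleftrightarrow> (\<forall>S. Sigma01 S \<and> closure S = UNIV \<longrightarrow> x \<in> S)"

definition computable_map :: "(cantor \<Rightarrow> cantor) \<Rightarrow> bool" where
  "computable_map T \<longleftrightarrow>
     (\<exists>f. computable f \<and> (\<forall>\<sigma>. T -` cylinder \<sigma> = Sigma01_set (f (str_code \<sigma>))))"

definition measure_preserving_map :: "(cantor \<Rightarrow> cantor) \<Rightarrow> bool" where
  "measure_preserving_map T \<longleftrightarrow> T \<in> borel_measurable borel \<and>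
     (\<forall>B\<in>sets borel. emeasure lam (T -` B) = emeasure lam B)"

end

(* From a dense Sigma01 set that omits x one computes g and sigma such that every string tau of
   length n has an extension sigma n tau of length g n which is not an initial segment of x, and
   from a Schnorr test that captures x one computes clopen sets V s, of measure at most
   2 ^ - g (n s) and decided by n (s + 1) bits, infinitely many of which contain x.  The
   complement of A is the union of the cylinders of the strings sigma (n s) tau, and T is the
   limit of permutations T s of the strings of length n s.  To pass from T s to T (s + 1), one
   composes it with an involution that, inside the cylinder of each tau of length n s, swaps V s
   with a part of the cylinder of sigma (n s) tau, which is large enough to receive it.  Each
   time V s contains x, the cycle of the initial segment of x doubles in length, and all other
   strings of the cycle stay outside A. *)
theory Submission
  imports Defs
begin

section \<open>Computable functions\<close>

text \<open>By Poincare recurrence almost every point of \<open>A\<close> returns to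
  \<open>A\<close>, so \<open>x\<close> can escape only by lying in a null set. The Schnorr test
  supplies this set, and the computability of its measures is what allows it to be cut into clopen
  pieces of prescribed size. At each finite stage the initial segment of \<open>x\<close> still
  returns; the return is merely postponed, and doubling it infinitely often postpones it forever.
  For the limit to exist and to be computable, later involutions must respect longer and longer
  initial segments. So room for the images of \<open>V s\<close> is needed inside every cylinder of
  length \<open>n s\<close>, the one around \<open>x\<close> included, and this room must be missing
  from \<open>A\<close>. A dense open set that omits \<open>x\<close> offers it. The room in one
  cylinder has measure \<open>2 ^ - g (n s)\<close>, which dictates the size of \<open>V s\<close>.
  Points removed from \<open>A\<close> at earlier stages are fixed by all later involutions, so what
  is achieved for the orbit persists. The growth \<open>2 * m + 2 \<le> g m\<close> makes the
  removed measure small and its tails computable.\<close>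

abbreviation pi1 :: "nat \<Rightarrow> nat" where "pi1 z \<equiv> fst (prod_decode z)"
abbreviation pi2 :: "nat \<Rightarrow> nat" where "pi2 z \<equiv> snd (prod_decode z)"

definition computable2 :: "(nat \<Rightarrow> nat \<Rightarrow> nat) \<Rightarrow> bool" where
  "computable2 F \<longleftrightarrow> computable (\<lambda>z. F (pi1 z) (pi2 z))"

definition computable3 :: "(nat \<Rightarrow> nat \<Rightarrow> nat \<Rightarrow> nat) \<Rightarrow> bool" where
  "computable3 F \<longleftrightarrow> computable (\<lambda>z. F (pi1 z) (pi1 (pi2 z)) (pi2 (pi2 z)))"

definition decidable :: "(nat \<Rightarrow> bool) \<Rightarrow> bool" where
  "decidable P \<longleftrightarrow> computable (\<lambda>a. of_bool (P a))"

definition decidable2 :: "(nat \<Rightarrow> nat \<Rightarrow> bool) \<Rightarrow> bool" where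
  "decidable2 P \<longleftrightarrow> decidable (\<lambda>z. P (pi1 z) (pi2 z))"

definition decidable3 :: "(nat \<Rightarrow> nat \<Rightarrow> nat \<Rightarrow> bool) \<Rightarrow> bool" where
  "decidable3 P \<longleftrightarrow> decidable (\<lambda>z. P (pi1 z) (pi1 (pi2 z)) (pi2 (pi2 z)))"

named_theorems computable_intros

lemma computable_iff_recf: "computable f \<longleftrightarrow> (\<exists>F. \<forall>n. eval F n (f n))"
proof
  assume "computable f"
  then obtain e where e: "\<And>n. \<exists>F. goedel F = e \<and> eval F n (f n)"
    unfolding computable_def phi_def by blast
  then obtain F where "goedel F = e" by blast
  then show "\<exists>F. \<forall>n. eval F n (f n)" using e goedel_inject by metis
qed (auto simp: computable_def phi_def)

lemma computable_compose:
  assumes "computable f" "computable g"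
  shows "computable (\<lambda>a. f (g a))"
  using assms unfolding computable_iff_recf by (meson eval.comp)

lemma computable_id [computable_intros]: "computable (\<lambda>a. a)"
  unfolding computable_iff_recf
proof (intro exI allI)
  show "eval (PairF FstF SndF) n n" for n
    using eval.pair[OF eval.fst eval.snd, of n] by simp
qed

lemma computable_Suc [computable_intros]: "computable f \<Longrightarrow> computable (\<lambda>a. Suc (f a))"
  by (rule computable_compose) (use eval.succ in \<open>auto simp: computable_iff_recf\<close>)

lemma computable_fst [computable_intros]: "computable f \<Longrightarrow> computable (\<lambda>a. pi1 (f a))"
  by (rule computable_compose) (use eval.fst in \<open>auto simp: computable_iff_recf\<close>)

lemma computable_snd [computable_intros]: "computable f \<Longrightarrow> computable (\<lambda>a. pi2 (f a))"
  by (rule computable_compose) (use eval.snd in \<open>auto simp: computable_iff_recf\<close>)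

lemma computable_const [computable_intros]: "computable (\<lambda>a. c)"
proof (induction c)
  case 0
  then show ?case using eval.zero by (auto simp: computable_iff_recf)
qed (rule computable_Suc)

lemma computable_pair [computable_intros]:
  "computable f \<Longrightarrow> computable g \<Longrightarrow> computable (\<lambda>a. prod_encode (f a, g a))"
  unfolding computable_iff_recf by (meson eval.pair)

lemma computable2_compose:
  assumes "computable2 F" "computable u" "computable v"
  shows "computable (\<lambda>a. F (u a) (v a))"
  using computable_compose[OF assms(1)[unfolded computable2_def] computable_pair[OF assms(2,3)]]
  by simp

lemma computable3_compose:
  assumes "computable3 F" "computable u" "computable v" "computable w"
  shows "computable (\<lambda>a. F (u a) (v a) (w a))"
  using computable_compose[OF assms(1)[unfolded computable3_def]
      computable_pair[OF assms(2) computable_pair[OF assms(3,4)]]]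
  by simp

lemma decidable_compose: "decidable P \<Longrightarrow> computable u \<Longrightarrow> decidable (\<lambda>a. P (u a))"
  unfolding decidable_def by (rule computable_compose)

lemma decidable2_compose:
  "decidable2 P \<Longrightarrow> computable u \<Longrightarrow> computable v \<Longrightarrow> decidable (\<lambda>a. P (u a) (v a))"
  using computable2_compose[of "\<lambda>a b. of_bool (P a b)" u v]
  by (simp add: decidable_def decidable2_def computable2_def)

lemma decidable3_compose:
  "decidable3 P \<Longrightarrow> computable u \<Longrightarrow> computable v \<Longrightarrow> computable w
    \<Longrightarrow> decidable (\<lambda>a. P (u a) (v a) (w a))"
  using computable3_compose[of "\<lambda>a b c. of_bool (P a b c)" u v w]
  by (simp add: decidable_def decidable3_def computable3_def)

lemma computable_rec [computable_intros]:
  assumes "computable f" "computable3 g" "computable h"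
  shows "computable (\<lambda>a. rec_nat (f a) (g a) (h a))"
proof -
  obtain F where F: "\<And>n. eval F n (f n)" using assms(1) computable_iff_recf by blast
  obtain G where G: "\<And>z. eval G z (g (pi1 z) (pi1 (pi2 z)) (pi2 (pi2 z)))"
    using assms(2) unfolding computable3_def computable_iff_recf by blast
  have "eval (PrecF F G) (prod_encode (a, n)) (rec_nat (f a) (g a) n)" for a n
  proof (induction n)
    case 0
    then show ?case using eval.prec_0[OF F] by simp
  next
    case (Suc n)
    then show ?case using eval.prec_Suc[OF Suc G] by simp
  qed
  then have "eval (PrecF F G) z (rec_nat (f (pi1 z)) (g (pi1 z)) (pi2 z))" for z
    by (metis prod.collapse prod_decode_inverse)
  then have "computable2 (\<lambda>a n. rec_nat (f a) (g a) n)"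
    unfolding computable2_def computable_iff_recf by blast
  then show ?thesis by (rule computable2_compose) (rule computable_id assms(3))+
qed

lemma computable_LeastI:
  assumes "decidable2 P" "\<And>a. \<exists>m. P a m"
  shows "computable (\<lambda>a. LEAST m. P a m)"
proof -
  obtain F where F: "\<And>z. eval F z (of_bool (P (pi1 z) (pi2 z)))"
    using assms(1) unfolding decidable2_def decidable_def computable_iff_recf by blast
  \<comment> \<open>\<open>MinF\<close> stops at the value 0 and demands positive values before it,
    whereas \<open>F\<close> returns 1 at a witness. \<open>D\<close> exchanges the two truth
    values.\<close>
  obtain D where D: "\<And>z. eval D z (rec_nat 1 (\<lambda>_ _. 0) z)"
    using computable_rec[of "\<lambda>a. 1" "\<lambda>a m r. 0" "\<lambda>a. a"] computable_const computable_id
    unfolding computable_iff_recf computable3_def by (metis (no_types, lifting))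
  define G where "G = CompF D F"
  have G: "eval G (prod_encode (a, m)) (of_bool (\<not> P a m))" for a m
    using eval.comp[OF F D, of "prod_encode (a, m)"] unfolding G_def
    by (cases "P a m") simp_all
  have "eval (MinF G) a (LEAST m. P a m)" for a
  proof (rule eval.min)
    show "eval G (prod_encode (a, LEAST m. P a m)) 0"
      using G[of a "LEAST m. P a m"] LeastI_ex[OF assms(2)] by simp
    show "\<forall>i<LEAST m. P a m. \<exists>y. eval G (prod_encode (a, i)) (Suc y)"
    proof (intro allI impI exI)
      fix i assume "i < (LEAST m. P a m)"
      then have "\<not> P a i" by (rule not_less_Least)
      then show "eval G (prod_encode (a, i)) (Suc 0)" using G[of a i] by simp
    qed
  qed
  then show ?thesis unfolding computable_iff_recf by blast
qed

section \<open>Arithmetic, comparisons and bounded quantifiers\<close>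

lemma computable_add [computable_intros]:
  assumes "computable f" "computable g"
  shows "computable (\<lambda>a. f a + g a)"
proof -
  have "computable (\<lambda>a. rec_nat (f a) (\<lambda>m r. Suc r) (g a))"
    by (intro computable_intros assms) (simp add: computable3_def, intro computable_intros)
  moreover have "rec_nat m (\<lambda>m r. Suc r) n = m + n" for m n :: nat by (induction n) auto
  ultimately show ?thesis by simp
qed

lemma computable_mult [computable_intros]:
  assumes "computable f" "computable g"
  shows "computable (\<lambda>a. f a * g a)"
proof -
  have "computable (\<lambda>a. rec_nat 0 (\<lambda>m r. r + f a) (g a))"
    by (intro computable_intros assms)
      (simp add: computable3_def, intro computable_intros computable_compose[OF assms(1)])
  moreover have "rec_nat 0 (\<lambda>m r. r + k) n = k * n" for k n :: nat by (induction n) auto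
  ultimately show ?thesis by simp
qed

lemma computable_power [computable_intros]:
  assumes "computable f" "computable g"
  shows "computable (\<lambda>a. f a ^ g a)"
proof -
  have "computable (\<lambda>a. rec_nat 1 (\<lambda>m r. r * f a) (g a))"
    by (intro computable_intros assms)
      (simp add: computable3_def, intro computable_intros computable_compose[OF assms(1)])
  moreover have "rec_nat 1 (\<lambda>m r. r * k) n = k ^ n" for k n :: nat by (induction n) auto
  ultimately show ?thesis by simp
qed

lemma computable_diff [computable_intros]:
  assumes "computable f" "computable g"
  shows "computable (\<lambda>a. f a - g a)"
proof -
  have pred: "computable (\<lambda>a. a - 1)"
  proof -
    have "computable (\<lambda>a. rec_nat 0 (\<lambda>m r. m) a)"
      by (intro computable_intros) (simp add: computable3_def, intro computable_intros)
    moreover have "rec_nat 0 (\<lambda>m r. m) a = a - 1" for a by (cases a) auto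
    ultimately show ?thesis by simp
  qed
  have "computable (\<lambda>a. rec_nat (f a) (\<lambda>m r. r - 1) (g a))"
    by (intro computable_intros assms)
      (simp add: computable3_def,
        intro computable_compose[OF pred, simplified] computable_intros)
  moreover have "rec_nat m (\<lambda>m r. r - 1) n = m - n" for m n :: nat by (induction n) auto
  ultimately show ?thesis by simp
qed

lemma computable_sum [computable_intros]:
  assumes "computable2 f" "computable h"
  shows "computable (\<lambda>a. \<Sum>i<h a. f a i)"
proof -
  have "computable (\<lambda>a. rec_nat 0 (\<lambda>m r. r + f a m) (h a))"
    by (intro computable_intros assms)
      (simp add: computable3_def, intro computable_intros computable2_compose[OF assms(1)])
  moreover have "rec_nat 0 (\<lambda>m r. r + k m) n = (\<Sum>i<n. k i)" for k :: "nat \<Rightarrow> nat" and n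
    by (induction n) auto
  ultimately show ?thesis by simp
qed

lemma computable_of_bool [computable_intros]:
  "decidable P \<Longrightarrow> computable (\<lambda>a. of_bool (P a))"
  by (simp add: decidable_def)

lemma decidable_le [computable_intros]:
  assumes "computable f" "computable g"
  shows "decidable (\<lambda>a. f a \<le> g a)"
proof -
  have "computable (\<lambda>a. 1 - (f a - g a))" by (intro computable_intros assms)
  moreover have "1 - (m - n) = of_bool (m \<le> n)" for m n :: nat by simp
  ultimately show ?thesis by (simp add: decidable_def)
qed

lemma decidable_not [computable_intros]:
  assumes "decidable P"
  shows "decidable (\<lambda>a. \<not> P a)"
proof -
  have "computable (\<lambda>a. 1 - of_bool (P a))" by (intro computable_intros assms)
  moreover have "1 - of_bool b = (of_bool (\<not> b) :: nat)" for b by simp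
  ultimately show ?thesis by (simp only: decidable_def)
qed

lemma decidable_conj [computable_intros]:
  assumes "decidable P" "decidable Q"
  shows "decidable (\<lambda>a. P a \<and> Q a)"
  using computable_mult[OF computable_of_bool[OF assms(1)] computable_of_bool[OF assms(2)]]
  by (simp add: decidable_def of_bool_conj)

lemma decidable_disj [computable_intros]:
  assumes "decidable P" "decidable Q"
  shows "decidable (\<lambda>a. P a \<or> Q a)"
proof -
  have "decidable (\<lambda>a. \<not> (\<not> P a \<and> \<not> Q a))" by (intro computable_intros assms)
  then show ?thesis by simp
qed

lemma decidable_imp [computable_intros]:
  assumes "decidable P" "decidable Q"
  shows "decidable (\<lambda>a. P a \<longrightarrow> Q a)"
proof -
  have "decidable (\<lambda>a. \<not> P a \<or> Q a)" by (intro computable_intros assms)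
  then show ?thesis by (simp only: imp_conv_disj)
qed

lemma decidable_less [computable_intros]:
  "computable f \<Longrightarrow> computable g \<Longrightarrow> decidable (\<lambda>a. f a < g a)"
  using decidable_le[of "\<lambda>a. Suc (f a)" g] by (simp add: computable_Suc Suc_le_eq)

lemma decidable_eq [computable_intros]:
  assumes "computable f" "computable g"
  shows "decidable (\<lambda>a. f a = g a)"
proof -
  have "decidable (\<lambda>a. f a \<le> g a \<and> g a \<le> f a)" by (intro computable_intros assms)
  then show ?thesis by (simp add: eq_iff)
qed

lemma computable_if [computable_intros]:
  assumes "decidable P" "computable f" "computable g"
  shows "computable (\<lambda>a. if P a then f a else g a)"
proof -
  have "computable (\<lambda>a. of_bool (P a) * f a + of_bool (\<not> P a) * g a)"
    by (intro computable_intros assms)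
  moreover have "of_bool b * m + of_bool (\<not> b) * n = (if b then m else n)" for b and m n :: nat
    by simp
  ultimately show ?thesis by (simp only:)
qed

lemma decidable_ex_less [computable_intros]:
  assumes "decidable2 P" "computable h"
  shows "decidable (\<lambda>a. \<exists>i<h a. P a i)"
proof -
  have "decidable (\<lambda>a. 0 < (\<Sum>i<h a. of_bool (P a i) :: nat))"
    by (intro computable_intros assms)
      (simp add: computable2_def, intro computable_intros assms(1)[unfolded decidable2_def])
  moreover have "0 < (\<Sum>i<n. of_bool (Q i) :: nat) \<longleftrightarrow> (\<exists>i<n. Q i)" for n :: nat and Q
    by (induction n) (auto simp: less_Suc_eq)
  ultimately show ?thesis by simp
qed

lemma decidable_all_less [computable_intros]:
  assumes "decidable2 P" "computable h"
  shows "decidable (\<lambda>a. \<forall>i<h a. P a i)"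
proof -
  have "decidable (\<lambda>a. \<not> (\<exists>i<h a. \<not> P a i))"
    by (intro computable_intros assms)
      (simp add: decidable2_def, intro computable_intros assms(1)[unfolded decidable2_def])
  then show ?thesis by simp
qed

lemma decidable_ex_le [computable_intros]:
  assumes "decidable2 P" "computable h"
  shows "decidable (\<lambda>a. \<exists>i\<le>h a. P a i)"
  using decidable_ex_less[OF assms(1) computable_Suc[OF assms(2)]] by (simp add: less_Suc_eq_le)

lemma decidable_all_le [computable_intros]:
  assumes "decidable2 P" "computable h"
  shows "decidable (\<lambda>a. \<forall>i\<le>h a. P a i)"
  using decidable_all_less[OF assms(1) computable_Suc[OF assms(2)]] by (simp add: less_Suc_eq_le)

text \<open>The quotient counts the positive multiples of \<open>b\<close> up to \<open>a\<close>,
  and as \<open>b > 0\<close> there are at most \<open>a\<close> of them. This reduces division to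
  bounded sums.\<close>

lemma div_eq_sum: "b > 0 \<Longrightarrow> a div b = (\<Sum>i<a. of_bool (Suc i * b \<le> a))" for a b :: nat
proof -
  assume b: "b > 0"
  have "Suc i * b \<le> a \<longleftrightarrow> i < a div b" for i
    using less_eq_div_iff_mult_less_eq[OF b, of "Suc i" a] by (simp add: Suc_le_eq)
  then have "(\<Sum>i<a. of_bool (Suc i * b \<le> a)) = card {i. i < a \<and> i < a div b}"
    by (simp add: sum_of_bool_eq Int_def)
  also have "{i. i < a \<and> i < a div b} = {..<a div b}"
    using div_le_dividend[of a b] by (auto intro: less_le_trans simp del: div_le_dividend)
  finally show ?thesis by simp
qed

lemma computable_div [computable_intros]:
  assumes "computable f" "computable g"
  shows "computable (\<lambda>a. f a div g a)"
proof -
  have "computable (\<lambda>a. if 0 < g a then \<Sum>i<f a. of_bool (Suc i * g a \<le> f a) else 0)"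
    by (intro computable_intros assms)
      (simp add: computable2_def,
        intro computable_intros computable_compose[OF assms(1)] computable_compose[OF assms(2)])
  moreover have "(if 0 < n then \<Sum>i<m. of_bool (Suc i * n \<le> m) else 0) = m div n" for m n :: nat
    using div_eq_sum[of n m] by simp
  ultimately show ?thesis by (simp only:)
qed

lemma computable_mod [computable_intros]:
  assumes "computable f" "computable g"
  shows "computable (\<lambda>a. f a mod g a)"
  unfolding modulo_nat_def by (intro computable_intros assms)

section \<open>A universal machine\<close>

lemma decidable_odd [computable_intros]: "computable f \<Longrightarrow> decidable (\<lambda>a. odd (f a))"
  unfolding odd_iff_mod_2_eq_one by (intro computable_intros)

lemma decidable_set_decode [computable_intros]:
  "computable f \<Longrightarrow> computable g \<Longrightarrow> decidable (\<lambda>a. f a \<in> set_decode (g a))"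
  unfolding set_decode_def mem_Collect_eq by (intro computable_intros)

text \<open>Since \<open>z < 2 ^ z \<le> c\<close>, a quantifier over the members of a certificate
  can be bounded by the certificate itself, which keeps validity decidable.\<close>

lemma set_decode_less: "z \<in> set_decode c \<Longrightarrow> z < c"
proof (rule ccontr)
  assume "z \<in> set_decode c" "\<not> z < c"
  then show False
    using div_less[OF le_less_trans[of c z, OF _ less_exp[of z]]] by (simp add: set_decode_def)
qed

text \<open>Codes of compound terms carry a positive tag, so subterms have strictly smaller codes.
  This drives the inductions on codes.\<close>

lemma less_prod_encode_2: "0 < k \<Longrightarrow> b < prod_encode (k, b)"
proof -
  have "n \<le> triangle n" for n by (induction n) auto
  from this[of "k + b"] show "0 < k \<Longrightarrow> b < prod_encode (k, b)" by (simp add: prod_encode_def)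
qed

text \<open>
  A certificate is a finite set, coded by \<^const>\<open>set_decode\<close>, of claims of two kinds: that
  \<open>phi e n m\<close> holds, and that \<open>e\<close> is the code of a term.  It is valid if each claim in
  it follows from others by one rule of \<^const>\<open>eval\<close> or \<^const>\<open>goedel\<close>.  The rules decrease
  \<open>(e, n)\<close> lexicographically, so there are no circular justifications.  Claims of the second kind
  are needed because \<open>PrecF f g\<close> is defined at \<open>prod_encode (a, 0)\<close> for every term \<open>g\<close>.
\<close>

definition evalcl :: "nat \<Rightarrow> nat \<Rightarrow> nat \<Rightarrow> nat \<Rightarrow> bool" where
  "evalcl c e n m \<longleftrightarrow> prod_encode (0, prod_encode (e, prod_encode (n, m))) \<in> set_decode c"

definition codecl :: "nat \<Rightarrow> nat \<Rightarrow> bool" where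
  "codecl c e \<longleftrightarrow> prod_encode (1, e) \<in> set_decode c"

text \<open>Intermediate values are searched only below \<open>c\<close>. This keeps the predicate
  decidable and loses nothing, since by \<open>evalcl_bounds\<close> every value claimed in
  \<open>c\<close> is below \<open>c\<close>.\<close>

definition eval_step :: "nat \<Rightarrow> nat \<Rightarrow> nat \<Rightarrow> nat \<Rightarrow> bool" where
  "eval_step c e n m \<longleftrightarrow>
     e = prod_encode (0, 0) \<and> m = 0 \<or>
     e = prod_encode (1, 0) \<and> m = Suc n \<or>
     e = prod_encode (2, 0) \<and> m = pi1 n \<or>
     e = prod_encode (3, 0) \<and> m = pi2 n \<or>
     pi1 e = 4 \<and> evalcl c (pi1 (pi2 e)) n (pi1 m) \<and> evalcl c (pi2 (pi2 e)) n (pi2 m) \<or>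
     pi1 e = 5 \<and> (\<exists>a<c. evalcl c (pi2 (pi2 e)) n a \<and> evalcl c (pi1 (pi2 e)) a m) \<or>
     pi1 e = 6 \<and> pi2 n = 0 \<and> evalcl c (pi1 (pi2 e)) (pi1 n) m \<and> codecl c (pi2 (pi2 e)) \<or>
     pi1 e = 6 \<and> 0 < pi2 n \<and> (\<exists>r<c. evalcl c e (prod_encode (pi1 n, pi2 n - 1)) r \<and>
        evalcl c (pi2 (pi2 e)) (prod_encode (pi1 n, prod_encode (pi2 n - 1, r))) m) \<or>
     pi1 e = 7 \<and> evalcl c (pi2 e) (prod_encode (n, m)) 0 \<and>
        (\<forall>i<m. \<exists>y<c. evalcl c (pi2 e) (prod_encode (n, i)) (Suc y))"

definition code_step :: "nat \<Rightarrow> nat \<Rightarrow> bool" where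
  "code_step c e \<longleftrightarrow>
     pi1 e \<le> 3 \<and> pi2 e = 0 \<or>
     4 \<le> pi1 e \<and> pi1 e \<le> 6 \<and> codecl c (pi1 (pi2 e)) \<and> codecl c (pi2 (pi2 e)) \<or>
     pi1 e = 7 \<and> codecl c (pi2 e)"

definition valid :: "nat \<Rightarrow> bool" where
  "valid c \<longleftrightarrow> (\<forall>z<c. z \<in> set_decode c \<longrightarrow>
     pi1 z = 0 \<and> eval_step c (pi1 (pi2 z)) (pi1 (pi2 (pi2 z))) (pi2 (pi2 (pi2 z))) \<or>
     pi1 z = 1 \<and> code_step c (pi2 z))"

lemma decidable_valid: "decidable valid"
  unfolding valid_def eval_step_def code_step_def evalcl_def codecl_def
  by (intro computable_intros; simp only: decidable2_def prod_encode_inverse)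
    (intro computable_intros; simp only: decidable2_def; intro computable_intros;
      simp only: decidable2_def; intro computable_intros)

lemma evalcl_bounds: "evalcl c e n m \<Longrightarrow> m < c"
  unfolding evalcl_def
  by (drule set_decode_less) (meson le_less_trans le_prod_encode_2)

lemma valid_eval_step: "valid c \<Longrightarrow> evalcl c e n m \<Longrightarrow> eval_step c e n m"
  unfolding valid_def evalcl_def
  by (drule spec[of _ "prod_encode (0, prod_encode (e, prod_encode (n, m)))"],
      frule set_decode_less) simp

lemma valid_code_step: "valid c \<Longrightarrow> codecl c e \<Longrightarrow> code_step c e"
  unfolding valid_def codecl_def
  by (drule spec[of _ "prod_encode (1, e)"], frule set_decode_less) simp

lemma codecl_imp_goedel:
  assumes "valid c" "codecl c e"
  shows "\<exists>f. goedel f = e"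
  using assms(2)
proof (induction e rule: less_induct)
  case (less e)
  define k where "k = pi1 e"
  define b where "b = pi2 e"
  define u where "u = pi1 b"
  define v where "v = pi2 b"
  have e: "e = prod_encode (k, b)" and b: "b = prod_encode (u, v)"
    by (simp_all add: k_def b_def u_def v_def)
  have lt: "u < e" "v < e" "b < e" if "0 < k"
    using less_prod_encode_2[OF that, of b] le_prod_encode_1[of u v] le_prod_encode_2[of v u]
    unfolding e b by linarith+
  have "code_step c e" using valid_code_step[OF assms(1) less.prems] .
  then consider "k \<le> 3" "b = 0" | "4 \<le> k" "k \<le> 6" "codecl c u" "codecl c v" | "k = 7" "codecl c b"
    unfolding code_step_def k_def b_def u_def v_def by metis
  then show ?case
  proof cases
    case 1
    then have "k = 0 \<or> k = 1 \<or> k = 2 \<or> k = 3" by auto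
    with 1 show ?thesis unfolding e using goedel.simps(1-4) by metis
  next
    case 2
    then obtain f g where "goedel f = u" "goedel g = v" using less.IH lt by fastforce
    moreover have "k = 4 \<or> k = 5 \<or> k = 6" using 2 by auto
    ultimately show ?thesis unfolding e b using goedel.simps(5-7) by metis
  next
    case 3
    then obtain f where "goedel f = b" using less.IH lt by fastforce
    then show ?thesis unfolding e using 3 goedel.simps(8) by metis
  qed
qed

text \<open>Strong induction on the code suffices for every rule except primitive recursion, where
  the code \<open>e\<close> recurs with a smaller argument; that case needs an inner induction on
  the argument.\<close>

lemma evalcl_imp_phi:
  assumes "valid c" "evalcl c e n m"
  shows "phi e n m"
  using assms(2)
proof (induction e arbitrary: n m rule: less_induct)
  case (less e)
  define k where "k = pi1 e"
  define b where "b = pi2 e"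
  define u where "u = pi1 b"
  define v where "v = pi2 b"
  have e: "e = prod_encode (k, b)" and b: "b = prod_encode (u, v)"
    by (simp_all add: k_def b_def u_def v_def)
  have lt: "u < e" "v < e" "b < e" if "0 < k"
    using less_prod_encode_2[OF that, of b] le_prod_encode_1[of u v] le_prod_encode_2[of v u]
    unfolding e b by linarith+
  have unfold: "eval_step c e n m" if "evalcl c e n m" for n m
    using valid_eval_step[OF assms(1) that] .
  note step = unfold[unfolded eval_step_def, folded b_def, folded u_def v_def, folded k_def]
  consider "k < 4" | "k = 4" | "k = 5" | "k = 6" | "k = 7" | "k > 7" by linarith
  then show ?case
  proof cases
    case 1
    with step[OF less.prems] consider "e = goedel ZeroF" "m = 0" | "e = goedel SuccF" "m = Suc n"
      | "e = goedel FstF" "m = pi1 n" | "e = goedel SndF" "m = pi2 n" by auto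
    then show ?thesis unfolding phi_def by cases (use eval.intros(1-4) in metis)+
  next
    case 2
    with step[OF less.prems] have "evalcl c u n (pi1 m)" "evalcl c v n (pi2 m)" by (auto simp: e)
    then obtain f g where "goedel f = u" "eval f n (pi1 m)" "goedel g = v" "eval g n (pi2 m)"
      using less.IH lt 2 unfolding phi_def by (metis zero_less_numeral)
    then have "goedel (PairF f g) = e" "eval (PairF f g) n m"
      using eval.pair[of f n "pi1 m" g "pi2 m"] 2 by (auto simp: e b)
    then show ?thesis unfolding phi_def by blast
  next
    case 3
    with step[OF less.prems] obtain a where "evalcl c v n a" "evalcl c u a m" by (auto simp: e)
    then obtain f g where "goedel f = u" "eval f a m" "goedel g = v" "eval g n a"
      using less.IH lt 3 unfolding phi_def by (metis zero_less_numeral)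
    then have "goedel (CompF f g) = e" "eval (CompF f g) n m"
      using eval.comp[of g n a f m] 3 by (auto simp: e b)
    then show ?thesis unfolding phi_def by blast
  next
    case 4
    then have pos: "0 < k" by simp
    have "evalcl c e (prod_encode (a, i)) m \<Longrightarrow> phi e (prod_encode (a, i)) m" for a i m
    proof (induction i arbitrary: m)
      case 0
      with step[OF 0] 4 have "evalcl c u a m" "codecl c v" by (auto simp: e)
      then obtain f g where "goedel f = u" "eval f a m" "goedel g = v"
        using less.IH lt(1)[OF pos] codecl_imp_goedel[OF assms(1)] unfolding phi_def by metis
      then have "goedel (PrecF f g) = e" "eval (PrecF f g) (prod_encode (a, 0)) m"
        using eval.prec_0[of f a m g] 4 by (auto simp: e b)
      then show ?case unfolding phi_def by blast
    next
      case (Suc i)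
      with step[OF Suc.prems] 4 obtain r where
        r: "evalcl c e (prod_encode (a, i)) r"
           "evalcl c v (prod_encode (a, prod_encode (i, r))) m" by (auto simp: e)
      from Suc.IH[OF r(1)] obtain h where h: "goedel h = e" "eval h (prod_encode (a, i)) r"
        unfolding phi_def by blast
      from less.IH[OF lt(2)[OF pos] r(2)] obtain g where
        g: "goedel g = v" "eval g (prod_encode (a, prod_encode (i, r))) m"
        unfolding phi_def by blast
      \<comment> \<open>The inner induction yields a term \<open>h\<close> of code \<open>e\<close>,
        the outer one a term \<open>g\<close> of code \<open>v\<close>. Injectivity of the coding
        shows that \<open>g\<close> is the step function of \<open>h\<close>.\<close>
      obtain f g' where h': "h = PrecF f g'"
        using h(1) 4 by (cases h) (auto simp: e)
      then have "g' = g" using h(1) g(1) goedel_inject by (auto simp: e b)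
      then have "eval h (prod_encode (a, Suc i)) m" using eval.prec_Suc h(2) g(2) h' by simp
      then show ?case using h(1) unfolding phi_def by blast
    qed
    from this[of "pi1 n" "pi2 n" m] show ?thesis using less.prems by simp
  next
    case 5
    then have pos: "0 < k" by simp
    with step[OF less.prems] 5 have *: "evalcl c b (prod_encode (n, m)) 0"
      "\<forall>i<m. \<exists>y<c. evalcl c b (prod_encode (n, i)) (Suc y)" by (auto simp: e)
    from less.IH[OF lt(3)[OF pos] *(1)] obtain f where
      f: "goedel f = b" "eval f (prod_encode (n, m)) 0" unfolding phi_def by blast
    have "\<exists>y. eval f (prod_encode (n, i)) (Suc y)" if "i < m" for i
      using *(2) that less.IH[OF lt(3)[OF pos]] f(1) goedel_inject unfolding phi_def by metis
    then have "eval (MinF f) n m" using eval.min f(2) by blast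
    moreover have "goedel (MinF f) = e" using f(1) 5 by (simp add: e)
    ultimately show ?thesis unfolding phi_def by blast
  next
    case 6
    with step[OF less.prems] show ?thesis by (auto simp: e)
  qed
qed

definition cert_le :: "nat \<Rightarrow> nat \<Rightarrow> bool" where
  "cert_le c d \<longleftrightarrow> set_decode c \<subseteq> set_decode d"

lemma cert_le_trans: "cert_le a b \<Longrightarrow> cert_le b c \<Longrightarrow> cert_le a c"
  unfolding cert_le_def by blast

lemma evalcl_mono: "cert_le c d \<Longrightarrow> evalcl c e n m \<Longrightarrow> evalcl d e n m"
  unfolding cert_le_def evalcl_def by blast

lemma codecl_mono: "cert_le c d \<Longrightarrow> codecl c e \<Longrightarrow> codecl d e"
  unfolding cert_le_def codecl_def by blast

lemma cert_le_imp_le: "cert_le c d \<Longrightarrow> c \<le> d"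
  unfolding cert_le_def by (rule subset_decode_imp_le)

text \<open>Claims occur only positively, and inclusion of certificates implies the order of their
  codes, so witnesses found below \<open>c\<close> remain below \<open>d\<close>.\<close>

lemma eval_step_mono: "cert_le c d \<Longrightarrow> eval_step c e n m \<Longrightarrow> eval_step d e n m"
  unfolding eval_step_def
  by (elim disj_forward conj_forward ex_forward; (elim conj_forward)?;
      (assumption | erule (1) evalcl_mono | erule (1) codecl_mono | (drule cert_le_imp_le, simp) |
        (meson evalcl_mono cert_le_imp_le less_le_trans)))

lemma code_step_mono: "cert_le c d \<Longrightarrow> code_step c e \<Longrightarrow> code_step d e"
  unfolding code_step_def using codecl_mono by blast

lemma valid_iff:
  "valid c \<longleftrightarrow> (\<forall>z\<in>set_decode c.
     pi1 z = 0 \<and> eval_step c (pi1 (pi2 z)) (pi1 (pi2 (pi2 z))) (pi2 (pi2 (pi2 z))) \<or>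
     pi1 z = 1 \<and> code_step c (pi2 z))"
  unfolding valid_def using set_decode_less by blast

lemma valid_union:
  assumes "valid c" "valid d"
  obtains u where "valid u" "cert_le c u" "cert_le d u"
proof
  define u where "u = set_encode (set_decode c \<union> set_decode d)"
  have u: "set_decode u = set_decode c \<union> set_decode d" by (simp add: u_def)
  then show *: "cert_le c u" "cert_le d u" by (auto simp: cert_le_def)
  show "valid u"
    using assms eval_step_mono[OF *(1)] eval_step_mono[OF *(2)]
      code_step_mono[OF *(1)] code_step_mono[OF *(2)]
    unfolding valid_iff u by blast
qed

lemma valid_add_eval:
  assumes "valid c" "eval_step c e n m"
  obtains u where "valid u" "cert_le c u" "evalcl u e n m"
proof
  define u where
    "u = set_encode (insert (prod_encode (0, prod_encode (e, prod_encode (n, m)))) (set_decode c))"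
  have u: "set_decode u = insert (prod_encode (0, prod_encode (e, prod_encode (n, m)))) (set_decode c)"
    by (simp add: u_def)
  then show *: "cert_le c u" by (auto simp: cert_le_def)
  show "evalcl u e n m" by (simp add: evalcl_def u)
  show "valid u"
    using assms eval_step_mono[OF *] code_step_mono[OF *] unfolding valid_iff u by auto
qed

lemma valid_add_code:
  assumes "valid c" "code_step c e"
  obtains u where "valid u" "cert_le c u" "codecl u e"
proof
  define u where "u = set_encode (insert (prod_encode (1, e)) (set_decode c))"
  have u: "set_decode u = insert (prod_encode (1, e)) (set_decode c)" by (simp add: u_def)
  then show *: "cert_le c u" by (auto simp: cert_le_def)
  show "codecl u e" by (simp add: codecl_def u)
  show "valid u"
    using assms eval_step_mono[OF *] code_step_mono[OF *] unfolding valid_iff u by auto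
qed

lemma valid_zero: "valid 0"
  by (simp add: valid_def)

lemma goedel_imp_codecl: "\<exists>c. valid c \<and> codecl c (goedel f)"
proof (induction f)
  case (PairF f g)
  then obtain c where "valid c" "codecl c (goedel f)" "codecl c (goedel g)"
    by (metis valid_union codecl_mono)
  then show ?case
    by (elim valid_add_code[of c "goedel (PairF f g)"]) (auto simp: code_step_def)
next
  case (CompF f g)
  then obtain c where "valid c" "codecl c (goedel f)" "codecl c (goedel g)"
    by (metis valid_union codecl_mono)
  then show ?case
    by (elim valid_add_code[of c "goedel (CompF f g)"]) (auto simp: code_step_def)
next
  case (PrecF f g)
  then obtain c where "valid c" "codecl c (goedel f)" "codecl c (goedel g)"
    by (metis valid_union codecl_mono)
  then show ?case
    by (elim valid_add_code[of c "goedel (PrecF f g)"]) (auto simp: code_step_def)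
next
  case (MinF f)
  then obtain c where "valid c" "codecl c (goedel f)" by blast
  then show ?case
    by (elim valid_add_code[of c "goedel (MinF f)"]) (auto simp: code_step_def)
qed (rule valid_add_code[OF valid_zero]; force simp: code_step_def)+

lemma eval_imp_evalcl: "eval f n m \<Longrightarrow> \<exists>c. valid c \<and> evalcl c (goedel f) n m"
proof (induction rule: eval.induct)
  case (pair f n a g b)
  then obtain c where "valid c" "evalcl c (goedel f) n a" "evalcl c (goedel g) n b"
    by (metis valid_union evalcl_mono)
  then show ?case
    by (elim valid_add_eval[of c "goedel (PairF f g)" n "prod_encode (a, b)"])
      (auto simp: eval_step_def)
next
  case (comp g n a f b)
  then obtain c where "valid c" "evalcl c (goedel f) a b" "evalcl c (goedel g) n a"
    by (metis valid_union evalcl_mono)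
  moreover from this(3) have "a < c" by (rule evalcl_bounds)
  ultimately show ?case
    by (elim valid_add_eval[of c "goedel (CompF f g)" n b]) (auto simp: eval_step_def)
next
  case (prec_0 f a b g)
  obtain c d where "valid c" "evalcl c (goedel f) a b" "valid d" "codecl d (goedel g)"
    using prec_0.IH goedel_imp_codecl by blast
  then obtain c where "valid c" "evalcl c (goedel f) a b" "codecl c (goedel g)"
    by (metis valid_union evalcl_mono codecl_mono)
  then show ?case
    by (elim valid_add_eval[of c "goedel (PrecF f g)" "prod_encode (a, 0)" b])
      (auto simp: eval_step_def)
next
  case (prec_Suc f g a m r b)
  then obtain c where c: "valid c" "evalcl c (goedel (PrecF f g)) (prod_encode (a, m)) r"
      "evalcl c (goedel g) (prod_encode (a, prod_encode (m, r))) b"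
    by (metis valid_union evalcl_mono)
  have "eval_step c (goedel (PrecF f g)) (prod_encode (a, Suc m)) b"
    unfolding eval_step_def using c(2,3) evalcl_bounds[OF c(2)]
    by (simp, intro exI[of _ r]) simp
  from valid_add_eval[OF c(1) this] show ?case by auto
next
  case (min f a m)
  from min.IH(1) obtain c where c: "valid c" "evalcl c (goedel f) (prod_encode (a, m)) 0" by blast
  \<comment> \<open>The values below \<open>m\<close> come with separate certificates. They are
    merged one at a time, always keeping the claims of \<open>c\<close>.\<close>
  have "\<exists>d. valid d \<and> cert_le c d \<and> (\<forall>i<j. \<exists>y. evalcl d (goedel f) (prod_encode (a, i)) (Suc y))"
    if "j \<le> m" for j
    using that
  proof (induction j)
    case 0
    then show ?case using c(1) by (auto simp: cert_le_def)
  next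
    case (Suc j)
    then obtain d where d: "valid d" "cert_le c d"
      "\<forall>i<j. \<exists>y. evalcl d (goedel f) (prod_encode (a, i)) (Suc y)" by auto
    from min.IH(2) Suc.prems obtain y d' where d': "valid d'"
      "evalcl d' (goedel f) (prod_encode (a, j)) (Suc y)" by (metis Suc_le_eq)
    from valid_union[OF d(1) d'(1)] obtain u where
      u: "valid u" "cert_le d u" "cert_le d' u" .
    have "\<exists>y. evalcl u (goedel f) (prod_encode (a, i)) (Suc y)" if "i < Suc j" for i
      using that d(3) d'(2) evalcl_mono[OF u(2)] evalcl_mono[OF u(3)] by (metis less_Suc_eq)
    then show ?case using u(1) cert_le_trans[OF d(2) u(2)] by blast
  qed
  then obtain d where d: "valid d" "cert_le c d"
    "\<forall>i<m. \<exists>y. evalcl d (goedel f) (prod_encode (a, i)) (Suc y)" by blast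
  have "\<exists>y<d. evalcl d (goedel f) (prod_encode (a, i)) (Suc y)" if "i < m" for i
    using d(3) that evalcl_bounds Suc_lessD by metis
  then have "eval_step d (goedel (MinF f)) a m"
    using evalcl_mono[OF d(2) c(2)] unfolding eval_step_def by simp
  from valid_add_eval[OF d(1) this] show ?case by auto
qed (rule valid_add_eval[OF valid_zero]; force simp: eval_step_def)+

lemma phi_iff_certificate: "phi e n m \<longleftrightarrow> (\<exists>c. valid c \<and> evalcl c e n m)"
  using evalcl_imp_phi eval_imp_evalcl unfolding phi_def by blast

lemma phi_det: "phi e n a \<Longrightarrow> phi e n b \<Longrightarrow> a = b"
  unfolding phi_def by (metis eval_det goedel_inject)

text \<open>Bounding the code of a certificate plays the part of a bound on the running time: the
  predicate is decidable, increasing in \<open>t\<close>, and bounds the value as well.\<close>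

definition stage :: "nat \<Rightarrow> nat \<Rightarrow> nat \<Rightarrow> nat \<Rightarrow> bool" where
  "stage t e n m \<longleftrightarrow> (\<exists>c\<le>t. valid c \<and> evalcl c e n m)"

lemma decidable_stage [computable_intros]:
  assumes "computable t" "computable e" "computable n" "computable m"
  shows "decidable (\<lambda>a. stage (t a) (e a) (n a) (m a))"
  unfolding stage_def evalcl_def
  by (intro computable_intros assms)
    (simp only: decidable2_def, intro computable_intros decidable_compose[OF decidable_valid]
      computable_compose[OF assms(2)] computable_compose[OF assms(3)] computable_compose[OF assms(4)])

lemma stage_mono: "stage s e n m \<Longrightarrow> s \<le> t \<Longrightarrow> stage t e n m"
  unfolding stage_def using le_trans by blast

lemma stage_bound: "stage t e n m \<Longrightarrow> m < t"
  unfolding stage_def using evalcl_bounds less_le_trans by blast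

lemma phi_iff_stage: "phi e n m \<longleftrightarrow> (\<exists>t. stage t e n m)"
  unfolding phi_iff_certificate stage_def by blast

text \<open>Uniformity provides indices by a computable function; this turns them into values, by
  one search over coded pairs of a stage and a value.\<close>

lemma computable_universal:
  assumes "computable e" "computable n" "\<And>a. \<exists>m. phi (e a) (n a) m"
  obtains q where "computable q" "\<And>a. phi (e a) (n a) (q a)"
proof
  define s where "s a = (LEAST s. stage (pi1 s) (e a) (n a) (pi2 s))" for a
  have ex: "\<exists>s. stage (pi1 s) (e a) (n a) (pi2 s)" for a
    using assms(3)[of a] unfolding phi_iff_stage by (metis fst_conv prod_encode_inverse snd_conv)
  have "computable s"
    unfolding s_def
    by (rule computable_LeastI[OF _ ex])
      (simp only: decidable2_def, intro computable_intros
        computable_compose[OF assms(1)] computable_compose[OF assms(2)])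
  then show "computable (\<lambda>a. pi2 (s a))" by (rule computable_snd)
  show "phi (e a) (n a) (pi2 (s a))" for a
    unfolding phi_iff_stage using LeastI_ex[OF ex, of a] by (auto simp: s_def)
qed

section \<open>Effectively open sets\<close>

text \<open>The instance of the s-m-n theorem that produces indices of c.e. sets: \<open>P a\<close>
  is a term with the constant \<open>a\<close> built in, and its code is found by primitive
  recursion on \<open>a\<close>.\<close>

lemma computable_pred_W:
  assumes "decidable2 Q"
  obtains f where "computable f" "\<And>a. W (f a) = {c. Q a c}"
proof -
  have "computable (\<lambda>z. of_bool (\<not> Q (pi1 (pi1 z)) (pi2 (pi1 z))))"
    by (intro computable_intros decidable2_compose[OF assms])
  then obtain G where G: "\<And>z. eval G z (of_bool (\<not> Q (pi1 (pi1 z)) (pi2 (pi1 z))))"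
    unfolding computable_iff_recf by blast
  \<comment> \<open>\<open>G\<close> ignores the search variable, so the search stops at 0 or
    never.\<close>
  have halt: "(\<exists>m. eval (MinF G) (prod_encode (a, c)) m) \<longleftrightarrow> Q a c" for a c
  proof
    assume "\<exists>m. eval (MinF G) (prod_encode (a, c)) m"
    then obtain m where "eval G (prod_encode (prod_encode (a, c), m)) 0"
      by (auto elim: eval_elims(9))
    then show "Q a c" using eval_det[OF G] by force
  next
    assume "Q a c"
    then have "eval G (prod_encode (prod_encode (a, c), 0)) 0"
      using G[of "prod_encode (prod_encode (a, c), 0)"] by simp
    then show "\<exists>m. eval (MinF G) (prod_encode (a, c)) m" using eval.min by blast
  qed
  define C where "C a = (CompF SuccF ^^ a) ZeroF" for a
  define I where "I = PairF FstF SndF"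
  define P where "P a = CompF (MinF G) (PairF (C a) I)" for a
  have C: "eval (C a) n a" for a n
    unfolding C_def by (induction a) (auto intro: eval.intros)
  have I: "eval I n n" for n
    using eval.pair[OF eval.fst eval.snd, of n] by (simp add: I_def)
  have P: "(\<exists>m. eval (P a) c m) \<longleftrightarrow> Q a c" for a c
  proof -
    have "eval (PairF (C a) I) c r \<longleftrightarrow> r = prod_encode (a, c)" for r
      using eval.pair[OF C I] eval_det by blast
    then have "eval (P a) c m \<longleftrightarrow> eval (MinF G) (prod_encode (a, c)) m" for m
      unfolding P_def by (metis eval.comp eval_elims(6))
    then show ?thesis using halt by simp
  qed
  have goedel_C: "goedel (C a) = rec_nat (goedel ZeroF)
      (\<lambda>_ r. prod_encode (5, prod_encode (goedel SuccF, r))) a" for a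
    unfolding C_def by (induction a) auto
  show thesis
  proof
    have "computable (\<lambda>a. goedel (C a))"
      unfolding goedel_C
      by (intro computable_intros) (simp only: computable3_def, intro computable_intros)
    then show "computable (\<lambda>a. goedel (P a))"
      unfolding P_def goedel.simps(5,6) by (intro computable_intros)
    show "W (goedel (P a)) = {c. Q a c}" for a
      using P[of a] goedel_inject unfolding W_def phi_def by auto
  qed
qed

lemma computable_realI:
  assumes "computable q" "\<And>n. \<bar>rat_of_code (q n) - r\<bar> \<le> (1/2) ^ n"
  shows "computable_real r"
  using assms unfolding computable_real_def real_index_def computable_def by blast

section \<open>Finite strings as binary numbers\<close>

definition pref :: "cantor \<Rightarrow> nat \<Rightarrow> nat" where
  "pref y n = horner_sum of_bool 2 (map y [0..<n])"

lemma bit_pref: "bit (pref y n) i \<longleftrightarrow> i < n \<and> y i"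
  by (auto simp: pref_def bit_horner_sum_bit_iff)

text \<open>The first symbol is the least significant bit, so truncating a string is reduction
  modulo a power of 2. Trailing zeros are invisible, hence lengths are always carried
  separately.\<close>

lemma pref_mod: "pref y n mod 2 ^ m = pref y (min m n)"
  unfolding take_bit_eq_mod[symmetric]
  by (rule bit_eqI) (auto simp: bit_take_bit_iff bit_pref)

lemma pref_less: "pref y n < 2 ^ n"
  using pref_mod[of y n n] by (metis min.idem mod_less_divisor zero_less_numeral zero_less_power)

lemma pref_bit: "pref (bit v) n = v mod 2 ^ n"
  unfolding take_bit_eq_mod[symmetric]
  by (rule bit_eqI) (auto simp: bit_take_bit_iff bit_pref)

lemma pref_eq_iff: "pref y n = pref z n \<longleftrightarrow> (\<forall>i<n. y i = z i)"
  by (simp add: bit_eq_iff bit_pref) blast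

definition strnum :: "nat \<Rightarrow> nat \<Rightarrow> nat" where
  "strnum n v = str_code (map (bit v) [0..<n])"

lemma strnum_pref: "m \<le> n \<Longrightarrow> strnum m (pref y n) = str_code (map y [0..<m])"
  unfolding strnum_def by (rule arg_cong[of _ _ str_code]) (simp add: bit_pref)

lemma str_code_inject: "str_code s = str_code t \<longleftrightarrow> s = t"
proof -
  have "inj (of_bool :: bool \<Rightarrow> nat)" by (auto simp: inj_def)
  then show ?thesis unfolding str_code_def list_encode_eq by (simp add: inj_map_eq_map)
qed

lemma strnum_inject:
  "strnum n v = strnum m w \<longleftrightarrow> n = m \<and> v mod 2 ^ n = w mod 2 ^ n"
proof -
  have "strnum n v = strnum n w \<longleftrightarrow> v mod 2 ^ n = w mod 2 ^ n"
    unfolding strnum_def str_code_inject pref_bit[symmetric] pref_eq_iff by auto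
  moreover have "strnum n v = strnum m w \<Longrightarrow> n = m"
    unfolding strnum_def str_code_inject by (metis diff_zero length_map length_upt)
  ultimately show ?thesis by auto
qed

text \<open>This allows a string to be recovered from its code by bounded search.\<close>

lemma le_strnum: "n \<le> strnum n v"
proof -
  have "length l \<le> list_encode l" for l
  proof (induction l)
    case (Cons a l)
    then show ?case using le_prod_encode_2[of "list_encode l" a] by simp
  qed simp
  from this[of "map of_bool (map (bit v) [0..<n])"] show ?thesis
    by (simp add: strnum_def str_code_def)
qed

lemma computable_strnum [computable_intros]:
  assumes "computable f" "computable g"
  shows "computable (\<lambda>a. strnum (f a) (g a))"
proof -
  have "computable (\<lambda>a. rec_nat 0
      (\<lambda>k r. Suc (prod_encode (of_bool (odd (g a div 2 ^ (f a - Suc k))), r))) (f a))"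
    by (intro computable_intros assms)
      (simp only: computable3_def, intro computable_intros computable_compose[OF assms(1)]
        computable_compose[OF assms(2)])
  moreover have "strnum n v = rec_nat 0
      (\<lambda>k r. Suc (prod_encode (of_bool (odd (v div 2 ^ (n - Suc k))), r))) n" for n v
  proof -
    \<comment> \<open>A list code grows at its head, so the recursion runs through the suffixes,
      starting from the last symbol.\<close>
    have "str_code (map (bit v) [n - k..<n]) = rec_nat 0
      (\<lambda>k r. Suc (prod_encode (of_bool (odd (v div 2 ^ (n - Suc k))), r))) k" if "k \<le> n" for k
      using that
    proof (induction k)
      case (Suc k)
      then have "[n - Suc k..<n] = (n - Suc k) # [n - k..<n]"
        using upt_conv_Cons[of "n - Suc k" n] by (simp add: Suc_diff_Suc)
      then show ?case using Suc by (simp add: str_code_def bit_iff_odd)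
    qed (simp add: str_code_def)
    from this[of n] show ?thesis by (simp add: strnum_def)
  qed
  ultimately show ?thesis by simp
qed

lemma Sigma01_set_eq: "Sigma01_set e = {y. \<exists>n. str_code (map y [0..<n]) \<in> W e}"
proof -
  have "y \<in> cylinder s \<longleftrightarrow> (\<exists>n. s = map y [0..<n])" for y s
  proof
    assume "y \<in> cylinder s"
    then have "s = map y [0..<length s]" by (intro nth_equalityI) (auto simp: cylinder_def)
    then show "\<exists>n. s = map y [0..<n]" by blast
  qed (auto simp: cylinder_def)
  then show ?thesis unfolding Sigma01_set_def by auto
qed

text \<open>Only strings of length at most \<open>t\<close> are looked up at stage \<open>t\<close>,
  so the part enumerated by then is clopen and decided by \<open>t\<close> bits. The bound
  \<open>r < t\<close> is harmless by \<open>stage_bound\<close>.\<close>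

definition Sigma01_stage :: "nat \<Rightarrow> nat \<Rightarrow> nat \<Rightarrow> bool" where
  "Sigma01_stage e t w \<longleftrightarrow> (\<exists>m\<le>t. \<exists>r<t. stage t e (strnum m w) r)"

lemma decidable_Sigma01_stage [computable_intros]:
  assumes "computable e" "computable t" "computable w"
  shows "decidable (\<lambda>a. Sigma01_stage (e a) (t a) (w a))"
  unfolding Sigma01_stage_def
  by (intro computable_intros assms; simp only: decidable2_def;
      intro computable_intros computable_compose[OF assms(1)] computable_compose[OF assms(2)]
        computable_compose[OF assms(3)]; simp only: decidable2_def;
      intro computable_intros computable_compose[OF assms(1)] computable_compose[OF assms(2)]
        computable_compose[OF assms(3)])

lemma Sigma01_stage_pref:
  "Sigma01_stage e t (pref y t) \<longleftrightarrow> (\<exists>m\<le>t. \<exists>r. stage t e (str_code (map y [0..<m])) r)"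
  unfolding Sigma01_stage_def using strnum_pref[of _ t y] stage_bound by metis

lemma Sigma01_stage_mono:
  "Sigma01_stage e s (pref y s) \<Longrightarrow> s \<le> t \<Longrightarrow> Sigma01_stage e t (pref y t)"
  unfolding Sigma01_stage_pref using stage_mono le_trans by blast

lemma mem_Sigma01_set_iff: "y \<in> Sigma01_set e \<longleftrightarrow> (\<exists>t. Sigma01_stage e t (pref y t))"
proof
  assume "y \<in> Sigma01_set e"
  then obtain n m t where t: "stage t e (str_code (map y [0..<n])) m"
    by (auto simp: Sigma01_set_eq W_def phi_iff_stage)
  have "Sigma01_stage e (max t n) (pref y (max t n))"
    unfolding Sigma01_stage_pref using stage_mono[OF t] max.cobounded1 max.cobounded2 by blast
  then show "\<exists>t. Sigma01_stage e t (pref y t)" ..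
qed (auto simp: Sigma01_stage_pref Sigma01_set_eq W_def phi_iff_stage)

lemma decidable_Sigma01:
  assumes "decidable3 R"
  obtains f where "computable f" "\<And>a. Sigma01_set (f a) = {y. \<exists>n. R a n (pref y n)}"
proof -
  \<comment> \<open>A number \<open>c\<close> that codes a string is decoded by bounded search;
    \<open>v < 2 ^ n\<close> selects one representative, because \<open>strnum\<close> ignores the
    higher bits.\<close>
  define Q where "Q a c \<longleftrightarrow> (\<exists>n\<le>c. \<exists>v<2 ^ c. c = strnum n v \<and> v < 2 ^ n \<and> R a n v)" for a c
  have "decidable2 Q"
    unfolding Q_def decidable2_def
    by (intro computable_intros; simp only: decidable2_def; intro computable_intros;
        simp only: decidable2_def; intro computable_intros decidable3_compose[OF assms])
  then obtain f where f: "computable f" "\<And>a. W (f a) = {c. Q a c}"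
    using computable_pred_W by blast
  have "Q a (str_code (map y [0..<n])) \<longleftrightarrow> R a n (pref y n)" for a n y
  proof -
    have *: "str_code (map y [0..<n]) = strnum n (pref y n)" by (simp add: strnum_pref)
    show ?thesis
    proof
      assume "Q a (str_code (map y [0..<n]))"
      then show "R a n (pref y n)"
        unfolding * Q_def strnum_inject using pref_less[of y n] by auto
    next
      assume "R a n (pref y n)"
      moreover have "(2::nat) ^ n \<le> 2 ^ strnum n (pref y n)"
        using le_strnum by (intro power_increasing) auto
      ultimately show "Q a (str_code (map y [0..<n]))"
        unfolding * Q_def using le_strnum pref_less[of y n] less_le_trans by blast
    qed
  qed
  then show thesis using that[of f] f by (auto simp: Sigma01_set_eq)
qed

section \<open>Topology and measure of sets decided by finitely many bits\<close>

lemma cylinder_eq_pref: "cylinder (map (bit v) [0..<n]) = {y. pref y n = v mod 2 ^ n}"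
  unfolding pref_bit[symmetric] pref_eq_iff cylinder_def by simp

lemma open_cylinder: "open (cylinder s)"
proof -
  have "cylinder s = (\<Inter>i\<in>{..<length s}. (\<lambda>x. x i) -` {s ! i})" by (auto simp: cylinder_def)
  moreover have "open ((\<lambda>x :: cantor. x i) -` {b})" for i b
    by (intro open_vimage continuous_on_product_coordinates discrete_topology_class.open_discrete)
  ultimately show ?thesis by auto
qed

lemma open_Sigma01_set: "open (Sigma01_set e)"
  unfolding Sigma01_set_def by (intro open_UN ballI open_cylinder)

lemma open_pref_eq: "open {y. pref y n = v}"
proof (cases "v < 2 ^ n")
  case True
  then show ?thesis using open_cylinder[of "map (bit v) [0..<n]"] by (simp add: cylinder_eq_pref)
next
  case False
  then have "{y. pref y n = v} = {}" using pref_less[of _ n] by auto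
  then show ?thesis by simp
qed

lemma open_pref: "open {y. P (pref y n)}"
proof -
  have "{y. P (pref y n)} = (\<Union>v\<in>{v. P v}. {y. pref y n = v})" by auto
  then show ?thesis using open_pref_eq by auto
qed

lemma sets_pref [measurable]: "{y. P (pref y n)} \<in> sets lam"
  unfolding sets_lam by (intro borel_open open_pref)

lemma measure_pref_eq: "v < 2 ^ n \<Longrightarrow> measure lam {y. pref y n = v} = (1/2) ^ n"
  using measure_cylinder[of "map (bit v) [0..<n]"] by (simp add: cylinder_eq_pref)

lemma measure_pref: "measure lam {y. P (pref y n)} = card {v. v < 2 ^ n \<and> P v} / 2 ^ n"
proof -
  interpret prob_space lam by (rule prob_space_lam)
  let ?V = "{v. v < 2 ^ n \<and> P v}"
  have "{y. P (pref y n)} = (\<Union>v\<in>?V. {y. pref y n = v})" using pref_less by auto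
  also have "measure lam \<dots> = (\<Sum>v\<in>?V. measure lam {y. pref y n = v})"
    by (rule finite_measure_finite_Union) (auto simp: disjoint_family_on_def)
  also have "\<dots> = card ?V / 2 ^ n"
    using measure_pref_eq[of _ n] by (simp add: power_divide)
  finally show ?thesis .
qed

lemma dense_meets_pref:
  assumes "closure S = UNIV" "open S" "v < 2 ^ n"
  obtains y where "y \<in> S" "pref y n = v"
proof -
  have "pref (bit v) n = v" using assms(3) by (simp add: pref_bit)
  then have "{y. pref y n = v} \<noteq> {}" by blast
  then have "S \<inter> {y. pref y n = v} \<noteq> {}"
    using open_Int_closure_eq_empty[OF open_pref_eq[of n v], of S] assms(1) by auto
  then show thesis using that by auto
qed

section \<open>Points that are not weakly 1-generic\<close>

text \<open>By density every \<tau> has an extension that is seen to lie in the open set, and as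
  there are only finitely many \<tau> of length \<open>n\<close>, a common length can be found by
  search. An initial segment of \<open>x\<close> of that kind would put \<open>x\<close> into the
  set.\<close>

lemma computable_extension_of_not_weakly_1_generic:
  assumes "\<not> weakly_1_generic x"
  obtains g \<sigma> where "computable g" "computable2 \<sigma>" "\<And>n. 2 * n + 2 \<le> g n"
    "\<And>n \<tau>. \<tau> < 2 ^ n \<Longrightarrow> \<sigma> n \<tau> < 2 ^ g n" "\<And>n \<tau>. \<tau> < 2 ^ n \<Longrightarrow> \<sigma> n \<tau> mod 2 ^ n = \<tau>"
    "\<And>n. pref x (g n) \<noteq> \<sigma> n (pref x n)"
proof -
  obtain e where e: "closure (Sigma01_set e) = UNIV" "x \<notin> Sigma01_set e"
    using assms unfolding weakly_1_generic_def Sigma01_def by blast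
  define ext where "ext n t \<tau> w \<longleftrightarrow> w < 2 ^ t \<and> w mod 2 ^ n = \<tau> \<and> Sigma01_stage e t w" for n t \<tau> w
  \<comment> \<open>The bound \<open>2 * n + 2\<close> makes the \<open>2 ^ n\<close> chosen
    cylinders of length \<open>g n\<close> have total measure at most
    \<open>(1/2) ^ (n + 2)\<close>.\<close>
  define ok where "ok n t \<longleftrightarrow> 2 * n + 2 \<le> t \<and> (\<forall>\<tau><2 ^ n. \<exists>w<2 ^ t. ext n t \<tau> w)" for n t
  have "\<exists>t. ok n t" for n
  proof -
    have "\<forall>\<^sub>F t in sequentially. \<exists>w<2 ^ t. ext n t \<tau> w" if \<tau>: "\<tau> < 2 ^ n" for \<tau>
    proof -
      obtain y where y: "y \<in> Sigma01_set e" "pref y n = \<tau>"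
        using dense_meets_pref[OF e(1) open_Sigma01_set \<tau>] .
      then obtain s where s: "Sigma01_stage e s (pref y s)" by (auto simp: mem_Sigma01_set_iff)
      have "ext n t \<tau> (pref y t)" if "max n s \<le> t" for t
        using that y(2) Sigma01_stage_mono[OF s] by (auto simp: ext_def pref_less pref_mod min_def)
      then show ?thesis using pref_less unfolding eventually_sequentially by blast
    qed
    then have "\<forall>\<^sub>F t in sequentially. \<forall>\<tau>\<in>{..<2 ^ n}. \<exists>w<2 ^ t. ext n t \<tau> w"
      by (intro eventually_ball_finite) auto
    then have "\<forall>\<^sub>F t in sequentially. ok n t"
      using eventually_ge_at_top[of "2 * n + 2"] by eventually_elim (auto simp: ok_def)
    then show ?thesis by (auto simp: eventually_sequentially)
  qed
  note ex_ok = this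
  define g where "g n = (LEAST t. ok n t)" for n
  have g: "ok n (g n)" for n using LeastI_ex[OF ex_ok] by (simp add: g_def)
  have comp_g: "computable g"
    unfolding g_def
    by (rule computable_LeastI[OF _ ex_ok])
      (simp only: decidable2_def ok_def ext_def; intro computable_intros;
        simp only: decidable2_def; intro computable_intros; simp only: decidable2_def;
        intro computable_intros)
  \<comment> \<open>The second disjunct makes the search total; it returns the default 0 when \<tau>
    is not a string of length \<open>n\<close>.\<close>
  define P where "P a w \<longleftrightarrow> ext (pi1 a) (g (pi1 a)) (pi2 a) w \<or> \<not> pi2 a < 2 ^ pi1 a" for a w
  have P: "\<exists>w. P a w" for a using g[of "pi1 a"] unfolding P_def ok_def by blast
  define \<sigma> where "\<sigma> n \<tau> = (LEAST w. P (prod_encode (n, \<tau>)) w)" for n \<tau>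
  have "ext n (g n) \<tau> (\<sigma> n \<tau>)" if "\<tau> < 2 ^ n" for n \<tau>
    using LeastI_ex[OF P[of "prod_encode (n, \<tau>)"]] that by (simp add: \<sigma>_def P_def)
  then have \<sigma>: "\<sigma> n \<tau> < 2 ^ g n" "\<sigma> n \<tau> mod 2 ^ n = \<tau>" "Sigma01_stage e (g n) (\<sigma> n \<tau>)"
    if "\<tau> < 2 ^ n" for n \<tau>
    using that by (auto simp: ext_def)
  have "computable (\<lambda>a. LEAST w. P a w)"
    by (rule computable_LeastI[OF _ P])
      (simp only: decidable2_def P_def ext_def, intro computable_intros computable_compose[OF comp_g])
  then have "computable2 \<sigma>" by (simp add: computable2_def \<sigma>_def)
  moreover have "pref x (g n) \<noteq> \<sigma> n (pref x n)" for n
    using \<sigma>(3)[OF pref_less[of x n]] e(2) unfolding mem_Sigma01_set_iff by metis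
  ultimately show thesis using that[of g \<sigma>] comp_g g \<sigma>(1,2) by (simp add: ok_def)
qed

section \<open>Points that are not Schnorr random\<close>

text \<open>Even codes stand for nonnegative integers and odd ones for negative integers. Passing to
  the positive part leaves quotients of natural numbers, which suffices for approximating
  measures.\<close>

lemma rat_of_code_eq:
  "rat_of_code q \<le> of_nat (if even (pi1 q) then pi1 q div 2 else 0) / of_nat (Suc (pi2 q))"
  "0 \<le> rat_of_code q \<Longrightarrow>
    rat_of_code q = of_nat (if even (pi1 q) then pi1 q div 2 else 0) / of_nat (Suc (pi2 q))"
proof -
  have neg: "rat_of_code q < 0" if "odd (pi1 q)"
    using that unfolding rat_of_code_def int_decode_def sum_decode_def
    by (cases "prod_decode q") (auto intro!: divide_neg_pos)
  have pos: "rat_of_code q = of_nat (pi1 q div 2) / of_nat (Suc (pi2 q))" if "even (pi1 q)"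
    using that unfolding rat_of_code_def int_decode_def sum_decode_def
    by (cases "prod_decode q") auto
  show "rat_of_code q \<le> of_nat (if even (pi1 q) then pi1 q div 2 else 0) / of_nat (Suc (pi2 q))"
    using neg pos by (cases "even (pi1 q)") auto
  show "0 \<le> rat_of_code q \<Longrightarrow>
    rat_of_code q = of_nat (if even (pi1 q) then pi1 q div 2 else 0) / of_nat (Suc (pi2 q))"
    using neg pos by (cases "even (pi1 q)") auto
qed

lemma sets_Sigma01_set [measurable]: "Sigma01_set e \<in> sets lam"
  unfolding sets_lam by (intro borel_open open_Sigma01_set)

lemma measure_Sigma01_stage_tendsto:
  "(\<lambda>t. measure lam {y. Sigma01_stage e t (pref y t)}) \<longlonglongrightarrow> measure lam (Sigma01_set e)"
proof -
  interpret prob_space lam by (rule prob_space_lam)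
  have "incseq (\<lambda>t. {y. Sigma01_stage e t (pref y t)})"
    unfolding incseq_def using Sigma01_stage_mono by blast
  moreover have "(\<Union>t. {y. Sigma01_stage e t (pref y t)}) = Sigma01_set e"
    by (auto simp: mem_Sigma01_set_iff)
  ultimately show ?thesis
    using finite_Lim_measure_incseq[of "\<lambda>t. {y. Sigma01_stage e t (pref y t)}",
        OF image_subsetI[OF sets_pref]] by auto
qed

text \<open>Enumeration alone never tells how much of an open set is still to come. Comparing the
  measure of a stage with an approximation of the full measure does, and here the test must be a
  Schnorr test.\<close>

lemma decidable_measure_modulus:
  assumes "computable f" "uniformly_computable_reals (\<lambda>k. measure lam (Sigma01_set (f k)))"
  obtains C where "decidable3 C" "\<And>k p. \<forall>\<^sub>F t in sequentially. C k p t"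
    "\<And>k p t. C k p t \<Longrightarrow>
      measure lam (Sigma01_set (f k) - {y. Sigma01_stage (f k) t (pref y t)}) \<le> (1/2) ^ p"
proof -
  interpret prob_space lam by (rule prob_space_lam)
  obtain e where e: "computable e" "\<And>k. real_index (e k) (measure lam (Sigma01_set (f k)))"
    using assms(2) unfolding uniformly_computable_reals_def by blast
  have "\<exists>m. phi (e (pi1 z)) (pi2 z) m" for z
    using e(2) unfolding real_index_def by blast
  from computable_universal[OF computable_compose[OF e(1) computable_fst[OF computable_id]]
          computable_snd[OF computable_id] this]
  obtain q where q: "computable q" "\<And>z. phi (e (pi1 z)) (pi2 z) (q z)" by blast
  define Q where "Q k p = q (prod_encode (k, p + 2))" for k p
  define l where "l k = measure lam (Sigma01_set (f k))" for k
  define c where "c k t = (\<Sum>w<2 ^ t. of_bool (Sigma01_stage (f k) t w) :: nat)" for k t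
  define nu where "nu k p = (if even (pi1 (Q k p)) then pi1 (Q k p) div 2 else 0)" for k p
  define de where "de k p = Suc (pi2 (Q k p))" for k p
  \<comment> \<open>With denominators cleared, this says that the approximation exceeds the measure
    of the stage by at most \<open>2 / 2 ^ (p + 2)\<close>. One half of that tolerance absorbs the
    error of the approximation and the other half makes the test succeed eventually. Conversely the
    remainder is at most \<open>3 / 2 ^ (p + 2)\<close>, which is below
    \<open>(1/2) ^ p\<close>.\<close>
  define C where
    "C k p t \<longleftrightarrow> nu k p * (2 ^ t * 2 ^ (p + 2)) \<le> (c k t * 2 ^ (p + 2) + 2 * 2 ^ t) * de k p" for k p t
  have Q: "\<bar>rat_of_code (Q k p) - l k\<bar> \<le> (1/2) ^ (p + 2)" for k p
    using e(2)[of k] q(2)[of "prod_encode (k, p + 2)"] phi_det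
    unfolding real_index_def l_def Q_def by (metis fst_conv prod_encode_inverse snd_conv)
  have c: "measure lam {y. Sigma01_stage (f k) t (pref y t)} = c k t / 2 ^ t" for k t
    by (simp add: measure_pref c_def sum_of_bool_eq Int_def)
  have C: "C k p t \<longleftrightarrow> nu k p / de k p \<le> c k t / 2 ^ t + 2 / 2 ^ (p + 2)" for k p t
  proof -
    have frac: "a / b \<le> c / d \<longleftrightarrow> a * d \<le> c * b" if "0 < b" "0 < d" for a b c d :: real
      using that by (simp add: divide_simps)
    have "C k p t \<longleftrightarrow>
        real (nu k p * (2 ^ t * 2 ^ (p + 2))) \<le> real ((c k t * 2 ^ (p + 2) + 2 * 2 ^ t) * de k p)"
      unfolding C_def of_nat_le_iff ..
    also have "\<dots> \<longleftrightarrow> nu k p / de k p \<le> (c k t * 2 ^ (p + 2) + 2 * 2 ^ t) / (2 ^ t * 2 ^ (p + 2))"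
      unfolding of_nat_mult of_nat_add of_nat_power of_nat_numeral
      by (rule frac[symmetric]) (simp_all add: de_def)
    also have "(c k t * 2 ^ (p + 2) + 2 * 2 ^ t) / (2 ^ t * 2 ^ (p + 2) :: real)
        = c k t / 2 ^ t + 2 / 2 ^ (p + 2)"
      by (simp add: field_simps)
    finally show ?thesis .
  qed
  have "computable2 Q"
    unfolding Q_def computable2_def by (intro computable_intros computable_compose[OF q(1)])
  note Q_comp = computable2_compose[OF this]
  have "computable2 c"
    unfolding c_def computable2_def
    by (intro computable_intros; simp only: computable2_def; intro computable_intros
        computable_compose[OF assms(1)])
  note c_comp = computable2_compose[OF this]
  have "decidable3 C"
    unfolding C_def decidable3_def nu_def de_def even_iff_mod_2_eq_zero
    by (intro computable_intros Q_comp c_comp)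
  moreover have "\<forall>\<^sub>F t in sequentially. C k p t" for k p
  proof -
    have "(\<lambda>t. c k t / 2 ^ t) \<longlonglongrightarrow> l k"
      using measure_Sigma01_stage_tendsto[of "f k"] by (simp add: c l_def)
    then have "\<forall>\<^sub>F t in sequentially. l k - 1 / 2 ^ (p + 2) < c k t / 2 ^ t"
      by (rule order_tendstoD) simp
    then show ?thesis
    proof eventually_elim
      case (elim t)
      show ?case
      proof (cases "0 \<le> rat_of_code (Q k p)")
        case True
        then have "nu k p / de k p \<le> l k + 1 / 2 ^ (p + 2)"
          using rat_of_code_eq(2)[OF True] Q[of k p] unfolding nu_def de_def
          by (simp add: power_divide abs_le_iff)
        moreover have "2 / 2 ^ (p + 2) = 2 * (1 / 2 ^ (p + 2) :: real)" by simp
        ultimately show ?thesis unfolding C using elim by linarith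
      next
        case False
        \<comment> \<open>A negative approximation has \<open>nu k p = 0\<close>, so the inequality
          is trivial.\<close>
        then have "odd (pi1 (Q k p))"
          unfolding rat_of_code_def int_decode_def sum_decode_def
          by (cases "prod_decode (Q k p)") (auto split: if_splits)
        then show ?thesis unfolding C by (simp add: nu_def)
      qed
    qed
  qed
  moreover have "measure lam (Sigma01_set (f k) - {y. Sigma01_stage (f k) t (pref y t)}) \<le> (1/2) ^ p"
    if "C k p t" for k p t
  proof -
    have "measure lam (Sigma01_set (f k) - {y. Sigma01_stage (f k) t (pref y t)}) = l k - c k t / 2 ^ t"
      by (subst finite_measure_Diff) (auto simp: l_def c mem_Sigma01_set_iff)
    moreover have "l k \<le> rat_of_code (Q k p) + 1 / 2 ^ (p + 2)"
      using Q[of k p] by (simp add: power_divide abs_le_iff)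
    moreover have "rat_of_code (Q k p) \<le> nu k p / de k p"
      using rat_of_code_eq(1)[of "Q k p"] by (simp add: nu_def de_def)
    moreover have "1 / 2 ^ (p + 2) + 2 / 2 ^ (p + 2) \<le> (1 / 2 :: real) ^ p"
      by (simp add: power_divide field_simps)
    ultimately show ?thesis using that[unfolded C] by linarith
  qed
  ultimately show thesis using that by blast
qed

text \<open>
  For a fast growing sequence \<open>t\<close>, the set \<open>V j\<close> consists of the part of \<open>U k\<close>, \<open>k \<le> t j\<close>, that is
  enumerated between the stages \<open>t (j + 1)\<close> and \<open>t (j + 2)\<close>, and of what is enumerated into
  \<open>U (g (t j) + 1)\<close> by stage \<open>t (j + 2)\<close>.  If the latter misses \<open>x\<close>, then \<open>x\<close> enters that set later,
  so it lies in some later \<open>V i\<close>.  As \<open>V j\<close> spans two steps of \<open>t\<close>, one finally keeps only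
  the \<open>j\<close> of one parity.
\<close>

lemma clopen_sequence_of_not_schnorr_random:
  assumes "\<not> schnorr_random x" "computable g"
  obtains n V where "computable n" "decidable2 V" "\<And>s. n s < n (Suc s)" "\<And>s. g (n s) \<le> n (Suc s)"
    "\<And>s. card {w. w < 2 ^ n (Suc s) \<and> V s w} * 2 ^ g (n s) \<le> 2 ^ n (Suc s)"
    "\<And>J. \<exists>s\<ge>J. V s (pref x (n (Suc s)))"
proof -
  interpret prob_space lam by (rule prob_space_lam)
  obtain U where U: "schnorr_test U" "\<And>k. x \<in> U k"
    using assms(1) unfolding schnorr_random_def by blast
  then obtain f where f: "computable f" "\<And>k. U k = Sigma01_set (f k)"
    unfolding schnorr_test_def uniformly_Sigma01_def by blast
  obtain C where C: "decidable3 C" "\<And>k p. \<forall>\<^sub>F t in sequentially. C k p t"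
    "\<And>k p t. C k p t \<Longrightarrow>
      measure lam (Sigma01_set (f k) - {y. Sigma01_stage (f k) t (pref y t)}) \<le> (1/2) ^ p"
    using decidable_measure_modulus[OF f(1)] U(1) f(2) unfolding schnorr_test_def by auto
  \<comment> \<open>The \<open>a + 1\<close> remainders with \<open>k \<le> a\<close> add up to at
    most \<open>(1/2) ^ (g a + 1)\<close>, because \<open>a + 1 \<le> 2 ^ a\<close>; the set with
    index \<open>g a + 1\<close> contributes the other half of \<open>(1/2) ^ g a\<close>. The
    growth condition makes that index admissible at all later steps.\<close>
  define D where "D a t \<longleftrightarrow> a + g a + 2 \<le> t \<and> (\<forall>k\<le>a. C k (g a + a + 1) t)" for a t
  have ex: "\<exists>t. D a t" for a
  proof -
    have "\<forall>\<^sub>F t in sequentially. \<forall>k\<in>{..a}. C k (g a + a + 1) t"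
      using C(2) by (intro eventually_ball_finite) auto
    then have "\<forall>\<^sub>F t in sequentially. D a t"
      using eventually_ge_at_top[of "a + g a + 2"] by eventually_elim (auto simp: D_def)
    then show ?thesis by (auto simp: eventually_sequentially)
  qed
  define h where "h a = (LEAST t. D a t)" for a
  have h: "D a (h a)" for a using LeastI_ex[OF ex] by (simp add: h_def)
  have comp_h: "computable h"
    unfolding h_def
    by (rule computable_LeastI[OF _ ex])
      (simp only: decidable2_def D_def; intro computable_intros computable_compose[OF assms(2)];
        simp only: decidable2_def;
        intro computable_intros decidable3_compose[OF C(1)] computable_compose[OF assms(2)])
  define t where "t j = rec_nat 0 (\<lambda>_. h) j" for j
  have t_Suc: "t (Suc j) = h (t j)" for j by (simp add: t_def)
  have comp_t: "computable t"
    unfolding t_def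
    by (intro computable_intros) (simp only: computable3_def, intro computable_intros
        computable_compose[OF comp_h])
  have t_step: "t j + g (t j) + 2 \<le> t (Suc j)" for j
    using h[of "t j"] by (simp add: t_Suc D_def)
  then have t_less: "t j < t (Suc j)" for j using t_step[of j] by linarith
  then have t_mono: "i \<le> j \<Longrightarrow> t i \<le> t j" for i j
    using lift_Suc_mono_le[of t i j] less_imp_le by blast
  have t_ge: "j \<le> t j" for j
  proof (induction j)
    case (Suc j)
    then show ?case using t_less[of j] by simp
  qed simp
  let ?S = "\<lambda>k i. Sigma01_stage (f k) i"
  define V where "V j w \<longleftrightarrow>
    (\<exists>k\<le>t j. ?S k (t (j + 2)) w \<and> \<not> ?S k (t (j + 1)) (w mod 2 ^ t (j + 1))) \<or>
    ?S (g (t j) + 1) (t (j + 2)) w" for j w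
  have V_pref: "V j (pref y (t (j + 2))) \<longleftrightarrow>
    (\<exists>k\<le>t j. ?S k (t (j + 2)) (pref y (t (j + 2))) \<and> \<not> ?S k (t (j + 1)) (pref y (t (j + 1)))) \<or>
    ?S (g (t j) + 1) (t (j + 2)) (pref y (t (j + 2)))" for j y
    using t_mono[of "j + 1" "j + 2"] by (simp add: V_def pref_mod min_def)
  have measure_V: "measure lam {y. V j (pref y (t (j + 2)))} \<le> (1/2) ^ g (t j)" for j
  proof -
    define a where "a = t j"
    \<comment> \<open>Forgetting the upper stage \<open>t (j + 2)\<close> leaves all that is
      enumerated after \<open>t (j + 1) = h a\<close>, which is what the modulus controls.\<close>
    define E where "E k = Sigma01_set (f k) - {y. ?S k (t (j + 1)) (pref y (t (j + 1)))}" for k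
    have E_sets: "E k \<in> events" for k unfolding E_def by measurable
    have E: "measure lam (E k) \<le> (1/2) ^ (g a + a + 1)" if "k \<le> a" for k
      using C(3)[of k "g a + a + 1" "h a"] h[of a] that
      by (simp add: E_def D_def t_Suc a_def del: power_Suc power_add)
    have "{y. V j (pref y (t (j + 2)))} \<subseteq> (\<Union>k\<le>a. E k) \<union> U (g a + 1)"
      unfolding V_pref E_def f(2) a_def by (fastforce simp: mem_Sigma01_set_iff simp del: add_2_eq_Suc')
    then have "measure lam {y. V j (pref y (t (j + 2)))} \<le> measure lam ((\<Union>k\<le>a. E k) \<union> U (g a + 1))"
      by (rule finite_measure_mono) (use E_sets in \<open>auto simp: f(2)\<close>)
    also have "\<dots> \<le> measure lam (\<Union>k\<le>a. E k) + measure lam (U (g a + 1))"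
      using E_sets by (intro measure_Un_le) (auto simp: f(2))
    also have "measure lam (\<Union>k\<le>a. E k) \<le> (\<Sum>k\<le>a. measure lam (E k))"
      using E_sets by (intro measure_UNION_le) auto
    also have "\<dots> \<le> (\<Sum>k\<le>a. (1/2) ^ (g a + a + 1))" using E by (intro sum_mono) auto
    also have "\<dots> = (a + 1) * (1/2) ^ a * (1/2) ^ (g a + 1)" by (simp add: power_add field_simps)
    also have "\<dots> \<le> 1 * (1/2) ^ (g a + 1)"
    proof (rule mult_right_mono)
      have "real (a + 1) \<le> 2 ^ a"
        using less_exp[of a] by (metis Suc_eq_plus1 Suc_leI of_nat_le_iff of_nat_numeral of_nat_power)
      then show "(a + 1) * (1/2) ^ a \<le> (1::real)" by (simp add: power_divide divide_simps)
    qed simp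
    also have "measure lam (U (g a + 1)) \<le> (1/2) ^ (g a + 1)"
      using U(1) unfolding schnorr_test_def by blast
    finally show ?thesis by (simp add: a_def)
  qed
  have card_V: "card {w. w < 2 ^ t (j + 2) \<and> V j w} * 2 ^ g (t j) \<le> 2 ^ t (j + 2)" for j
  proof -
    have "card {w. w < 2 ^ t (j + 2) \<and> V j w} / 2 ^ t (j + 2) \<le> 1 / 2 ^ g (t j)"
      using measure_V[of j] unfolding measure_pref by (simp add: power_divide)
    then have "real (card {w. w < 2 ^ t (j + 2) \<and> V j w} * 2 ^ g (t j)) \<le> real (2 ^ t (j + 2))"
      by (simp add: field_simps)
    then show ?thesis by (simp only: of_nat_le_iff)
  qed
  have io: "\<exists>j\<ge>J. V j (pref x (t (j + 2)))" for J
  proof -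
    define k where "k = g (t J) + 1"
    have "x \<in> Sigma01_set (f k)" using U(2) f(2) by simp
    then obtain e where "?S k e (pref x e)" by (auto simp: mem_Sigma01_set_iff)
    then have exi: "\<exists>i. ?S k (t i) (pref x (t i))" using Sigma01_stage_mono t_ge by blast
    define i where "i = (LEAST i. ?S k (t i) (pref x (t i)))"
    have i: "?S k (t i) (pref x (t i))" unfolding i_def by (rule LeastI_ex[OF exi])
    show ?thesis
    proof (cases "i \<le> J + 2")
      case True
      then have "?S k (t (J + 2)) (pref x (t (J + 2)))"
        using Sigma01_stage_mono[OF i t_mono] by blast
      then show ?thesis unfolding V_pref k_def by blast
    next
      case False
      define j where "j = i - 2"
      with False have j: "i = j + 2" "J < j" by auto
      have "\<not> ?S k (t (j + 1)) (pref x (t (j + 1)))"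
        using not_less_Least[of "j + 1" "\<lambda>i. ?S k (t i) (pref x (t i))"] j(1) by (simp add: i_def)
      \<comment> \<open>Here \<open>J < j\<close> matters: \<open>t (Suc J)\<close> already exceeds
        \<open>g (t J) + 1\<close>.\<close>
      moreover have "k \<le> t j" using t_step[of J] t_mono[of "Suc J" j] j(2) by (simp add: k_def)
      ultimately have "V j (pref x (t (j + 2)))" unfolding V_pref using i j(1) by blast
      then show ?thesis using j(2) less_imp_le by blast
    qed
  qed
  have "\<exists>b. \<forall>J. \<exists>s\<ge>J. V (2 * s + b) (pref x (t (2 * s + b + 2)))"
  proof (rule ccontr)
    assume "\<not> ?thesis"
    then obtain J0 J1 where J: "\<And>s. J0 \<le> s \<Longrightarrow> \<not> V (2 * s) (pref x (t (2 * s + 2)))"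
      "\<And>s. J1 \<le> s \<Longrightarrow> \<not> V (2 * s + 1) (pref x (t (2 * s + 1 + 2)))"
      by (metis add.right_neutral)
    obtain j where j: "2 * (J0 + J1) \<le> j" "V j (pref x (t (j + 2)))" using io by blast
    have "j = 2 * (j div 2) \<or> j = 2 * (j div 2) + 1" by linarith
    moreover have "J0 \<le> j div 2" "J1 \<le> j div 2" using j(1) by auto
    ultimately show False using J j(2) by metis
  qed
  then obtain b where b: "\<And>J. \<exists>s\<ge>J. V (2 * s + b) (pref x (t (2 * s + b + 2)))" by blast
  \<comment> \<open>After thinning to one parity, the level \<open>t (j + 2)\<close> that decides
    \<open>V j\<close> is the next member of the sequence.\<close>
  have eq: "2 * Suc s + b = 2 * s + b + 2" for s by simp
  show thesis
  proof (rule that[of "\<lambda>s. t (2 * s + b)" "\<lambda>s. V (2 * s + b)"], unfold eq)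
    show "computable (\<lambda>s. t (2 * s + b))" by (intro computable_intros computable_compose[OF comp_t])
    show "decidable2 (\<lambda>s. V (2 * s + b))"
      unfolding V_def decidable2_def
      by (intro computable_intros computable_compose[OF comp_t] computable_compose[OF f(1)]
          computable_compose[OF assms(2)]; simp only: decidable2_def;
          intro computable_intros computable_compose[OF comp_t] computable_compose[OF f(1)])
    show "t (2 * s + b) < t (2 * s + b + 2)" for s
      using t_less[of "2 * s + b"] t_less[of "2 * s + b + 1"] by simp
    show "g (t (2 * s + b)) \<le> t (2 * s + b + 2)" for s
      using t_step[of "2 * s + b"] t_less[of "2 * s + b + 1"] by simp
  qed (use card_V b in auto)
qed

section \<open>Permutations of strings and their limit\<close>

definition acts_low :: "nat \<Rightarrow> (nat \<Rightarrow> nat) \<Rightarrow> bool" where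
  "acts_low k F \<longleftrightarrow> (\<forall>u i. k \<le> i \<longrightarrow> bit (F u) i = bit u i) \<and>
     (\<forall>u v. take_bit k u = take_bit k v \<longrightarrow> take_bit k (F u) = take_bit k (F v))"

lemma take_bit_eq_iff: "take_bit k u = take_bit k v \<longleftrightarrow> (\<forall>i<k. bit u i = bit v i)"
  for u v :: nat
  by (auto simp: bit_eq_iff bit_take_bit_iff)

lemma take_bit_coarsen:
  "take_bit m u = take_bit m v \<Longrightarrow> k \<le> m \<Longrightarrow> take_bit k u = take_bit k v" for u v :: nat
  by (auto simp: take_bit_eq_iff)

lemma acts_low_mono:
  assumes "acts_low k F" "k \<le> m"
  shows "acts_low m F"
  unfolding acts_low_def
proof (intro conjI allI impI)
  show "bit (F u) i = bit u i" if "m \<le> i" for u i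
    using assms that unfolding acts_low_def by simp
  show "take_bit m (F u) = take_bit m (F v)" if "take_bit m u = take_bit m v" for u v
  proof -
    have "take_bit k (F u) = take_bit k (F v)"
      using assms take_bit_coarsen[OF that assms(2)] unfolding acts_low_def by blast
    then have "bit (F u) i = bit (F v) i" if "i < m" for i
      using assms(1) that \<open>take_bit m u = take_bit m v\<close>
      unfolding acts_low_def take_bit_eq_iff by (cases "i < k") auto
    then show ?thesis by (simp add: take_bit_eq_iff)
  qed
qed

lemma acts_low_comp: "acts_low k F \<Longrightarrow> acts_low k G \<Longrightarrow> acts_low k (\<lambda>u. F (G u))"
  unfolding acts_low_def by blast

lemma acts_low_less:
  assumes "acts_low k F" "u < 2 ^ k"
  shows "F u < 2 ^ k"
proof -
  have "\<not> bit u i" if "k \<le> i" for i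
    using assms(2) that by (metis bit_take_bit_iff not_le take_bit_nat_eq_self_iff)
  then have "take_bit k (F u) = F u"
    using assms(1) unfolding acts_low_def
    by (intro bit_eqI) (metis bit_take_bit_iff not_le)
  then show ?thesis by (simp add: take_bit_nat_eq_self_iff)
qed

lemma take_bit_pref: "take_bit m (pref y n) = pref y (min m n)"
  by (simp add: take_bit_eq_mod pref_mod)

text \<open>
  A string of length \<open>k\<close> is identified with a number below \<open>2 ^ k\<close>; permutations of such strings
  are maps on all numbers that act on the lowest \<open>k\<close> bits only.
\<close>

locale swap_construction =
  fixes g n :: "nat \<Rightarrow> nat" and \<sigma> :: "nat \<Rightarrow> nat \<Rightarrow> nat" and V :: "nat \<Rightarrow> nat \<Rightarrow> bool"
  assumes computable_g: "computable g" and computable_n: "computable n"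
    and computable_\<sigma>: "computable2 \<sigma>" and decidable_V: "decidable2 V"
    and g_ge: "2 * m + 2 \<le> g m"
    and \<sigma>_less: "\<tau> < 2 ^ m \<Longrightarrow> \<sigma> m \<tau> < 2 ^ g m"
    and \<sigma>_mod: "\<tau> < 2 ^ m \<Longrightarrow> \<sigma> m \<tau> mod 2 ^ m = \<tau>"
    and n_less: "n s < n (Suc s)" and g_le: "g (n s) \<le> n (Suc s)"
    and card_V: "card {w. w < 2 ^ n (Suc s) \<and> V s w} * 2 ^ g (n s) \<le> 2 ^ n (Suc s)"
begin

definition target :: "nat \<Rightarrow> nat \<Rightarrow> bool" where
  "target s u \<longleftrightarrow> take_bit (g (n s)) u = \<sigma> (n s) (take_bit (n s) u)"

text \<open>The part of the complement of \<open>A\<close> that is removed before stage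
  \<open>s\<close>.\<close>

definition B :: "nat \<Rightarrow> nat \<Rightarrow> bool" where
  "B s u \<longleftrightarrow> (\<exists>i<s. target i u)"

text \<open>Leaving out \<open>B s\<close> protects the orbit obtained so far, and leaving out
  \<open>target s\<close> separates sources from their images, so that exchanging them is an
  involution.\<close>

definition source :: "nat \<Rightarrow> nat \<Rightarrow> bool" where
  "source s u \<longleftrightarrow> V s (take_bit (n (Suc s)) u) \<and> \<not> B (Suc s) u"

definition rank :: "nat \<Rightarrow> nat \<Rightarrow> nat" where
  "rank s u = card {w. w < u \<and> take_bit (n s) w = take_bit (n s) u \<and> source s w}"

text \<open>The rank among the sources of the same cylinder is written into the bits from position
  \<open>g (n s)\<close> on, which are free inside the cylinder of
  \<open>\<sigma> (n s) \<tau>\<close>.\<close>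

definition img :: "nat \<Rightarrow> nat \<Rightarrow> nat" where
  "img s u = \<sigma> (n s) (take_bit (n s) u) + 2 ^ g (n s) * rank s u"

text \<open>
  As \<open>img s\<close> is injective on sources, the sum is the only preimage of \<open>u\<close>.
\<close>

definition swap :: "nat \<Rightarrow> nat \<Rightarrow> nat" where
  "swap s u = (if source s u then img s u
     else if \<exists>w<2 ^ n (Suc s). source s w \<and> img s w = u
     then \<Sum>w<2 ^ n (Suc s). of_bool (source s w \<and> img s w = u) * w else u)"

definition P :: "nat \<Rightarrow> nat \<Rightarrow> nat" where
  "P s u = 2 ^ n (Suc s) * (u div 2 ^ n (Suc s)) + swap s (u mod 2 ^ n (Suc s))"

definition T :: "nat \<Rightarrow> nat \<Rightarrow> nat" where
  "T s u = rec_nat u P s"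

lemma T_0 [simp]: "T 0 u = u" and T_Suc [simp]: "T (Suc s) u = P s (T s u)"
  by (simp_all add: T_def)

lemma n_mono: "s \<le> r \<Longrightarrow> n s \<le> n r"
  using lift_Suc_mono_le[of n s r] less_imp_le[OF n_less] by blast

lemma n_ge: "s \<le> n s"
proof (induction s)
  case (Suc s)
  then show ?case using n_less[of s] by simp
qed simp

lemma target_cong:
  assumes "take_bit (n (Suc s)) u = take_bit (n (Suc s)) v"
  shows "target s u \<longleftrightarrow> target s v"
  unfolding target_def
  using take_bit_coarsen[OF assms g_le] take_bit_coarsen[OF assms less_imp_le[OF n_less]] by simp

lemma B_cong:
  assumes "take_bit (n s) u = take_bit (n s) v"
  shows "B s u \<longleftrightarrow> B s v"
  unfolding B_def
  using target_cong[OF take_bit_coarsen[OF assms n_mono]] by (auto simp: Suc_le_eq)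

lemma B_Suc: "B (Suc s) u \<longleftrightarrow> B s u \<or> target s u"
  unfolding B_def by (auto simp: less_Suc_eq)

lemma source_cong:
  assumes "take_bit (n (Suc s)) u = take_bit (n (Suc s)) v"
  shows "source s u \<longleftrightarrow> source s v"
  unfolding source_def using assms B_cong[OF assms] by simp

lemma take_bit_less: "take_bit k u < 2 ^ k" for u :: nat
  by (simp add: take_bit_eq_mod)

lemma take_bit_g_img: "take_bit (g (n s)) (img s u) = \<sigma> (n s) (take_bit (n s) u)"
  using \<sigma>_less[OF take_bit_less] by (simp add: img_def take_bit_eq_mod)

lemma take_bit_n_img: "take_bit (n s) (img s u) = take_bit (n s) u"
proof -
  have "n s \<le> g (n s)" using g_ge[of "n s"] by simp
  then have "take_bit (n s) (img s u) = take_bit (n s) (take_bit (g (n s)) (img s u))"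
    by (simp add: min_def)
  also have "\<dots> = take_bit (n s) u"
    using \<sigma>_mod[OF take_bit_less, of "n s" u] unfolding take_bit_g_img
    by (simp add: take_bit_eq_mod)
  finally show ?thesis .
qed

lemma target_img: "target s (img s u)"
  by (simp add: target_def take_bit_g_img take_bit_n_img)

lemma not_source_img: "\<not> source s (img s u)"
  using target_img[of s u] by (auto simp: source_def B_Suc)

text \<open>A rank is smaller than the number of strings in \<open>V s\<close>, and
  \<open>card_V\<close> says that this many ranks fit into the free bits. A single target cylinder
  could hold all of \<open>V s\<close>, so its distribution over the cylinders is
  irrelevant.\<close>

lemma img_less:
  assumes "source s u" "u < 2 ^ n (Suc s)"
  shows "img s u < 2 ^ n (Suc s)"
proof -
  let ?A = "{w. w < 2 ^ n (Suc s) \<and> V s w}"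
  have V: "V s w" if "source s w" "w < 2 ^ n (Suc s)" for w
    using that by (simp add: source_def take_bit_nat_eq_self_iff[THEN iffD2])
  have "rank s u < card ?A"
    unfolding rank_def using assms V
    by (intro psubset_card_mono) (auto dest: less_trans)
  then have "(rank s u + 1) * 2 ^ g (n s) \<le> card ?A * 2 ^ g (n s)" by (intro mult_right_mono) auto
  also have "\<dots> \<le> 2 ^ n (Suc s)" by (rule card_V)
  finally show ?thesis using \<sigma>_less[OF take_bit_less, of "n s" u] by (simp add: img_def algebra_simps)
qed

lemma img_inject:
  assumes "source s u" "source s v" "img s u = img s v"
  shows "u = v"
proof -
  have less: False if "source s u" "u < v" "img s u = img s v" for u v
  proof -
    have t: "take_bit (n s) u = take_bit (n s) v" using that(3) take_bit_n_img by metis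
    then have "rank s u < rank s v"
      unfolding rank_def using that by (intro psubset_card_mono) auto
    then show False using that(3) by (simp add: img_def t)
  qed
  show ?thesis using less[of u v] less[of v u] assms by (metis linorder_neqE_nat)
qed

lemma swap_source: "source s u \<Longrightarrow> swap s u = img s u"
  by (simp add: swap_def)

lemma swap_img:
  assumes "source s w" "w < 2 ^ n (Suc s)"
  shows "swap s (img s w) = w"
proof -
  have "source s v \<and> img s v = img s w \<longleftrightarrow> v = w" for v using assms(1) img_inject by blast
  then have "swap s (img s w) = (\<Sum>v<2 ^ n (Suc s). of_bool (v = w) * v)"
    using assms(2) not_source_img[of s w] by (simp add: swap_def)
  also have "\<dots> = (\<Sum>v<2 ^ n (Suc s). if v = w then v else 0)"
    by (rule sum.cong) auto
  finally show ?thesis using assms(2) by simp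
qed

text \<open>An image shares its first \<open>n s\<close> bits with a source outside
  \<open>B s\<close>, and \<open>B s\<close> depends on these bits only, so images avoid
  \<open>B s\<close> too. Hence nothing removed earlier is moved.\<close>

lemma swap_other:
  assumes "\<not> source s u" "\<not> target s u \<or> B s u"
  shows "swap s u = u"
proof -
  have "img s w \<noteq> u" if "source s w" for w
    using that target_img[of s w] B_cong[OF take_bit_n_img, of s w] assms(2)
    by (auto simp: source_def B_Suc)
  then show ?thesis using assms(1) unfolding swap_def by auto
qed

lemma swap_cases:
  obtains "source s u" "swap s u = img s u"
  | w where "source s w" "w < 2 ^ n (Suc s)" "u = img s w" "swap s u = w"
  | "swap s u = u"
proof (cases "source s u \<or> (\<exists>w<2 ^ n (Suc s). source s w \<and> img s w = u)")
  case True
  then show thesis using that(1,2) swap_source swap_img by blast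
next
  case False
  then have "swap s u = u" unfolding swap_def by auto
  then show thesis by (rule that(3))
qed

lemma swap_less: "u < 2 ^ n (Suc s) \<Longrightarrow> swap s u < 2 ^ n (Suc s)"
  by (cases rule: swap_cases[of s u]) (auto simp: img_less)

lemma swap_swap: "u < 2 ^ n (Suc s) \<Longrightarrow> swap s (swap s u) = u"
  by (cases rule: swap_cases[of s u]) (auto simp: swap_img swap_source)

lemma take_bit_n_swap: "take_bit (n s) (swap s u) = take_bit (n s) u"
  by (cases rule: swap_cases[of s u]) (auto simp: take_bit_n_img)

lemma take_bit_P: "take_bit (n (Suc s)) (P s u) = swap s (take_bit (n (Suc s)) u)"
  using swap_less[of "u mod 2 ^ n (Suc s)" s] by (simp add: P_def take_bit_eq_mod)

lemma drop_bit_P: "drop_bit (n (Suc s)) (P s u) = drop_bit (n (Suc s)) u"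
  using swap_less[of "u mod 2 ^ n (Suc s)" s] by (simp add: P_def drop_bit_eq_div)

lemma bit_P: "n (Suc s) \<le> i \<Longrightarrow> bit (P s u) i = bit u i"
  using arg_cong[OF drop_bit_P[of s u], of "\<lambda>v. bit v (i - n (Suc s))"]
  by (simp add: bit_drop_bit_eq)

lemma nat_eq_take_drop: "take_bit k u = take_bit k v \<Longrightarrow> drop_bit k u = drop_bit k v \<Longrightarrow> u = v"
  for u v :: nat
  by (metis bits_ident)

lemma P_P: "P s (P s u) = u"
  by (rule nat_eq_take_drop[of "n (Suc s)"])
    (simp_all add: take_bit_P drop_bit_P swap_swap[OF take_bit_less])

lemma acts_low_P: "acts_low (n (Suc s)) (P s)"
  by (auto simp: acts_low_def bit_P take_bit_P)

text \<open>The reason for convergence: the involution of stage \<open>s\<close> changes no output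
  bit below \<open>n s\<close>, so those bits are final.\<close>

lemma take_bit_n_P: "take_bit (n s) (P s u) = take_bit (n s) u"
proof -
  have "take_bit (n s) v = take_bit (n s) (take_bit (n (Suc s)) v)" for v :: nat
    using n_less[of s] by (simp add: min_def)
  then show ?thesis
    using take_bit_n_swap take_bit_P by metis
qed

lemma target_take: "target s (take_bit (n (Suc s)) u) \<longleftrightarrow> target s u"
  by (rule target_cong) simp

lemma source_take: "source s (take_bit (n (Suc s)) u) \<longleftrightarrow> source s u"
  by (rule source_cong) simp

lemma B_take: "B s (take_bit (n (Suc s)) u) \<longleftrightarrow> B s u"
  using n_less[of s] by (intro B_cong) (simp add: min_def)

lemma P_fixes:
  assumes "\<not> source s u" "\<not> target s u \<or> B s u"
  shows "P s u = u"
  by (rule nat_eq_take_drop[of "n (Suc s)"])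
    (use assms in \<open>simp_all add: take_bit_P drop_bit_P swap_other source_take target_take B_take\<close>)

lemma target_P:
  assumes "source s u"
  shows "target s (P s u)"
  using target_img[of s "take_bit (n (Suc s)) u"] assms target_take[of s "P s u"]
  by (simp add: take_bit_P swap_source source_take)

lemma acts_low_T: "acts_low (n s) (T s)"
proof (induction s)
  case 0
  then show ?case by (simp add: acts_low_def)
next
  case (Suc s)
  show ?case
    using acts_low_comp[OF acts_low_P acts_low_mono[OF Suc less_imp_le[OF n_less]]] by simp
qed

lemma inj_T: "inj (T s)"
proof (induction s)
  case (Suc s)
  then show ?case unfolding inj_def by simp (metis P_P)
qed (simp add: inj_def)

lemma take_bit_T:
  assumes "s \<le> r"
  shows "take_bit (n s) (T r u) = take_bit (n s) (T s u)"
  using assms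
proof (induction rule: dec_induct)
  case (step r)
  then show ?case
    using take_bit_coarsen[OF take_bit_n_P[of r "T r u"] n_mono[of s r]] by simp
qed simp

text \<open>As \<open>i < n (Suc i)\<close>, bit \<open>i\<close> of the output is settled at step
  \<open>Suc i\<close>.\<close>

definition T_lim :: "cantor \<Rightarrow> cantor" where
  "T_lim y i = bit (T (Suc i) (pref y (n (Suc i)))) i"

lemma take_bit_T_pref:
  assumes "s \<le> r"
  shows "take_bit (n s) (T r (pref y (n r))) = T s (pref y (n s))"
proof -
  have "take_bit (n s) (T r (pref y (n r))) = take_bit (n s) (T s (pref y (n r)))"
    by (rule take_bit_T[OF assms])
  also have "\<dots> = take_bit (n s) (T s (pref y (n s)))"
    using acts_low_T n_mono[OF assms] unfolding acts_low_def by (simp add: take_bit_pref min_def)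
  also have "\<dots> = T s (pref y (n s))"
    using acts_low_less[OF acts_low_T pref_less] by (simp add: take_bit_nat_eq_self_iff)
  finally show ?thesis .
qed

text \<open>Through this identity, measures, preimages of cylinders and finite pieces of orbits of
  the limit are all computed at one finite stage.\<close>

lemma pref_T_lim: "pref (T_lim y) (n s) = T s (pref y (n s))"
proof (rule bit_eqI)
  fix i
  show "bit (pref (T_lim y) (n s)) i = bit (T s (pref y (n s))) i"
  proof (cases "i < n s")
    case True
    have "i < n (Suc i)" using n_ge[of "Suc i"] by simp
    then have "bit (T (Suc i) (pref y (n (Suc i)))) i = bit (T s (pref y (n s))) i"
      using take_bit_T_pref[of s "Suc i" y] take_bit_T_pref[of "Suc i" s y] True
      by (metis bit_take_bit_iff nat_le_linear)
    then show ?thesis using True by (simp add: bit_pref T_lim_def)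
  next
    case False
    then have "bit (T s (pref y (n s))) i = bit (pref y (n s)) i"
      using acts_low_T unfolding acts_low_def by simp
    then show ?thesis using False by (simp add: bit_pref)
  qed
qed

lemma pref_T_lim_funpow: "pref ((T_lim ^^ k) y) (n s) = (T s ^^ k) (pref y (n s))"
  by (induction k) (simp_all add: pref_T_lim)

end

section \<open>Computability of the permutations and invariance of the measure\<close>

context swap_construction
begin

lemma decidable_target [computable_intros]:
  assumes "computable f" "computable h"
  shows "decidable (\<lambda>a. target (f a) (h a))"
proof -
  have "decidable2 target"
    unfolding decidable2_def target_def take_bit_eq_mod
    by (intro computable_intros computable_compose[OF computable_n]
        computable_compose[OF computable_g] computable2_compose[OF computable_\<sigma>])
  then show ?thesis using assms by (rule decidable2_compose)
qed

lemma decidable_B [computable_intros]: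
  assumes "computable f" "computable h"
  shows "decidable (\<lambda>a. B (f a) (h a))"
proof -
  have "decidable2 B"
    unfolding decidable2_def B_def
    by (intro computable_intros) (simp only: decidable2_def, intro computable_intros)
  then show ?thesis using assms by (rule decidable2_compose)
qed

lemma decidable_source [computable_intros]:
  assumes "computable f" "computable h"
  shows "decidable (\<lambda>a. source (f a) (h a))"
proof -
  have "decidable2 source"
    unfolding decidable2_def source_def take_bit_eq_mod
    by (intro computable_intros computable_compose[OF computable_n]
        decidable2_compose[OF decidable_V])
  then show ?thesis using assms by (rule decidable2_compose)
qed

lemma computable_img [computable_intros]:
  assumes "computable f" "computable h"
  shows "computable (\<lambda>a. img (f a) (h a))"
proof -
  have "rank s u = (\<Sum>w<u. of_bool (take_bit (n s) w = take_bit (n s) u \<and> source s w))" for s u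
    by (simp add: rank_def sum_of_bool_eq Int_def)
  then have "computable2 img"
    unfolding computable2_def img_def take_bit_eq_mod
    by (simp only:) (intro computable_intros computable_compose[OF computable_n]
        computable_compose[OF computable_g] computable2_compose[OF computable_\<sigma>];
        simp only: computable2_def; intro computable_intros computable_compose[OF computable_n])
  then show ?thesis using assms by (rule computable2_compose)
qed

lemma computable_swap [computable_intros]:
  assumes "computable f" "computable h"
  shows "computable (\<lambda>a. swap (f a) (h a))"
proof -
  have "computable2 swap"
    unfolding computable2_def swap_def
    by (intro computable_intros computable_compose[OF computable_n];
        simp only: computable2_def decidable2_def; intro computable_intros)
  then show ?thesis using assms by (rule computable2_compose)
qed

lemma computable_T [computable_intros]:
  assumes "computable f" "computable h"
  shows "computable (\<lambda>a. T (f a) (h a))"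
  unfolding T_def
  by (intro computable_intros assms) (simp only: computable3_def P_def,
      intro computable_intros computable_compose[OF computable_n])

lemma card_T_vimage: "card {v. v < 2 ^ n s \<and> Q (T s v)} = card {v. v < 2 ^ n s \<and> Q v}"
proof -
  have "T s ` {..<2 ^ n s} = {..<2 ^ n s}"
    using acts_low_less[OF acts_low_T, of _ s] inj_T[of s]
    by (intro endo_inj_surj) (auto intro: inj_on_subset)
  then have "T s ` {v. v < 2 ^ n s \<and> Q (T s v)} = {v. v < 2 ^ n s \<and> Q v}"
    by (auto simp: set_eq_iff image_iff) (metis lessThan_iff)+
  then show ?thesis using card_image[OF inj_on_subset[OF inj_T]] by (metis subset_UNIV)
qed

lemma measure_T_lim_vimage:
  "measure lam {y. Q (pref (T_lim y) m)} = measure lam {y. Q (pref y m)}"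
proof -
  have eq: "pref y m = take_bit m (pref y (n m))" for y
    using n_ge[of m] by (simp add: take_bit_pref min_def)
  show ?thesis
    unfolding eq pref_T_lim measure_pref[of "\<lambda>v. Q (take_bit m (T m v))"]
      measure_pref[of "\<lambda>v. Q (take_bit m v)"] card_T_vimage[of m "\<lambda>v. Q (take_bit m v)"] ..
qed

lemma T_lim_vimage_pref: "\<exists>Q' k. {y. Q (pref (T_lim y) m)} = {y. Q' (pref y k)}"
proof (intro exI)
  have "pref (T_lim y) m = take_bit m (T m (pref y (n m)))" for y
    using n_ge[of m] by (simp add: take_bit_pref min_def flip: pref_T_lim)
  then show "{y. Q (pref (T_lim y) m)} = {y. (\<lambda>v. Q (take_bit m (T m v))) (pref y (n m))}" by simp
qed

end

section \<open>Clopen sets as a generator of the Borel sets\<close>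

definition clopens :: "cantor set set" where
  "clopens = {{y. Q (pref y m)} | Q m. True}"

lemma clopensI: "{y. Q (pref y m)} \<in> clopens"
  unfolding clopens_def by (intro CollectI exI[of _ Q] exI[of _ m] conjI refl TrueI)

lemma sigma_sets_clopens: "sets (borel :: cantor measure) = sigma_sets UNIV clopens"
proof
  have "clopens \<subseteq> sets (borel :: cantor measure)"
    using sets_pref unfolding sets_lam clopens_def by auto
  then show "sigma_sets UNIV clopens \<subseteq> sets (borel :: cantor measure)"
    using sets.sigma_sets_subset[of clopens "borel :: cantor measure"] by simp
next
  have "{f :: cantor. f i \<in> A} \<in> clopens" for i A
  proof -
    have "{f :: cantor. f i \<in> A} = {y. bit (pref y (Suc i)) i \<in> A}" by (simp add: bit_pref)
    then show ?thesis using clopensI[of "\<lambda>v. bit v i \<in> A" "Suc i"] by simp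
  qed
  then show "sets (borel :: cantor measure) \<subseteq> sigma_sets UNIV clopens"
    unfolding sets_lam[symmetric] lam_def sets_PiM_single
    by (simp add: space_uniform_count_measure) (intro sigma_sets_mono', auto)
qed

lemma Int_stable_clopens: "Int_stable clopens"
proof (rule Int_stableI)
  fix a b assume "a \<in> clopens" "b \<in> clopens"
  then obtain Q m R k where ab: "a = {y. Q (pref y m)}" "b = {y. R (pref y k)}"
    unfolding clopens_def by blast
  have "pref y m = take_bit m (pref y (max m k))" "pref y k = take_bit k (pref y (max m k))" for y
    by (simp_all add: take_bit_pref min_def)
  then have "a \<inter> b = {y. (\<lambda>v. Q (take_bit m v) \<and> R (take_bit k v)) (pref y (max m k))}"
    unfolding ab by auto
  then show "a \<inter> b \<in> clopens"
    using clopensI[of "\<lambda>v. Q (take_bit m v) \<and> R (take_bit k v)" "max m k"] by simp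
qed

text \<open>The measure and its image under \<open>F\<close> agree on an intersection-stable
  generator, hence on all Borel sets.\<close>

lemma measure_preserving_map_clopensI:
  assumes "\<And>S. S \<in> clopens \<Longrightarrow> F -` S \<in> clopens"
    and "\<And>S. S \<in> clopens \<Longrightarrow> measure lam (F -` S) = measure lam S"
  shows "measure_preserving_map F"
proof -
  interpret prob_space lam by (rule prob_space_lam)
  have clopens: "clopens \<subseteq> sets borel" unfolding sigma_sets_clopens by auto
  have F: "F \<in> borel_measurable borel"
    by (rule measurable_sigma_sets[OF sigma_sets_clopens]) (use assms(1) clopens in auto)
  then have F': "F \<in> measurable lam borel" using measurable_cong_sets[OF sets_lam refl] by blast
  have "lam = distr lam borel F"
  proof (rule measure_eqI_generator_eq[OF Int_stable_clopens, of UNIV _ _ "\<lambda>_. UNIV"])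
    show "emeasure lam X = emeasure (distr lam borel F) X" if "X \<in> clopens" for X
      using assms(2)[OF that] clopens that F' by (simp add: emeasure_distr emeasure_eq_measure subset_iff)
    show "range (\<lambda>_::nat. UNIV) \<subseteq> clopens"
      using clopensI[of "\<lambda>_. True"] by auto
  qed (auto simp: sets_lam sigma_sets_clopens)
  then have "emeasure lam (F -` S) = emeasure lam S" if "S \<in> sets borel" for S
    using emeasure_distr[OF F' that] by simp
  then show ?thesis using F unfolding measure_preserving_map_def by blast
qed

context swap_construction
begin

lemma measure_preserving_T_lim: "measure_preserving_map T_lim"
proof (rule measure_preserving_map_clopensI)
  fix S assume "S \<in> clopens"
  then obtain Q m where S: "S = {y. Q (pref y m)}" unfolding clopens_def by blast
  then show "T_lim -` S \<in> clopens"
    using T_lim_vimage_pref[of Q m] unfolding clopens_def by auto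
  show "measure lam (T_lim -` S) = measure lam S"
    using measure_T_lim_vimage[of Q m] by (simp add: S vimage_def)
qed

lemma computable_T_lim: "computable_map T_lim"
proof -
  \<comment> \<open>For a string of length \<open>l\<close>, the \<open>n l\<close> input bits on
    which \<open>T l\<close> acts decide membership, because \<open>l \<le> n l\<close>.\<close>
  define R where "R a m v \<longleftrightarrow>
    (\<exists>l\<le>a. \<exists>z<2 ^ a. a = strnum l z \<and> m = n l \<and> T l v mod 2 ^ l = z mod 2 ^ l)" for a m v
  have "decidable3 R"
    unfolding decidable3_def R_def
    by (intro computable_intros; simp only: decidable2_def; intro computable_intros;
        simp only: decidable2_def; intro computable_intros computable_compose[OF computable_n])
  then obtain f where f: "computable f" "\<And>a. Sigma01_set (f a) = {y. \<exists>m. R a m (pref y m)}"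
    using decidable_Sigma01 by blast
  have "T_lim -` cylinder s = Sigma01_set (f (str_code s))" for s
  proof -
    define l where "l = length s"
    define z where "z = pref (\<lambda>i. s ! i) l"
    have s: "s = map (bit z) [0..<l]"
      by (rule nth_equalityI) (auto simp: z_def l_def bit_pref)
    then have code: "str_code s = strnum l z" by (simp add: strnum_def)
    have "z < 2 ^ l" by (simp add: z_def pref_less)
    also have "(2 :: nat) ^ l \<le> 2 ^ strnum l z" using le_strnum by (intro power_increasing) auto
    finally have z: "z < 2 ^ strnum l z" .
    have R: "R (strnum l z) m v \<longleftrightarrow> m = n l \<and> T l v mod 2 ^ l = z mod 2 ^ l" for m v
      unfolding R_def strnum_inject using z le_strnum[of l z] by metis
    have "pref (T_lim y) l = T l (pref y (n l)) mod 2 ^ l" for y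
      using n_ge[of l] by (simp add: pref_mod min_def flip: pref_T_lim)
    then have "T_lim -` {y. pref y l = z mod 2 ^ l} = Sigma01_set (f (strnum l z))"
      unfolding f(2) R by auto
    then show ?thesis unfolding code s[unfolded l_def[symmetric]] cylinder_eq_pref
      by (simp add: strnum_def)
  qed
  then show ?thesis using f(1) unfolding computable_map_def by blast
qed

section \<open>The set \<open>A\<close> and its measure\<close>

definition A :: "cantor set" where
  "A = {y. \<forall>s. \<not> B s (pref y (n s))}"

lemma Pi01_A: "Pi01 A"
proof -
  define R where "R a m v \<longleftrightarrow> (\<exists>s\<le>m. m = n s \<and> B s v)" for a m v :: nat
  have "decidable3 R"
    unfolding decidable3_def R_def
    by (intro computable_intros; simp only: decidable2_def;
        intro computable_intros computable_compose[OF computable_n])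
  then obtain f where "computable f" "\<And>a. Sigma01_set (f a) = {y. \<exists>m. R a m (pref y m)}"
    using decidable_Sigma01 by blast
  then have "- A = Sigma01_set (f 0)" unfolding A_def R_def using n_ge by auto
  then show ?thesis unfolding Pi01_def Sigma01_def by blast
qed

text \<open>At most \<open>2 ^ N\<close> cylinders of length \<open>g N \<ge> 2 * N + 2\<close> are
  added, where \<open>N = n s \<ge> s\<close>.\<close>

lemma measure_B_Suc:
  "measure lam {y. B (Suc s) (pref y (n (Suc s)))} \<le>
    measure lam {y. B s (pref y (n s))} + (1/2) ^ (s + 2)"
proof -
  interpret prob_space lam by (rule prob_space_lam)
  define N where "N = n s"
  define Q where "Q v \<longleftrightarrow> v = \<sigma> N (take_bit N v)" for v
  have N: "s \<le> N" "2 * N + 2 \<le> g N" using n_ge g_ge by (auto simp: N_def)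
  have "B s (pref y (n (Suc s))) \<longleftrightarrow> B s (pref y (n s))" for y
    by (rule B_cong) (use n_less[of s] in \<open>simp add: take_bit_pref min_def\<close>)
  moreover have "target s (pref y (n (Suc s))) \<longleftrightarrow> Q (pref y (g N))" for y
    using g_le[of s] n_less[of s] N by (simp add: target_def Q_def N_def take_bit_pref min_def)
  ultimately have "{y. B (Suc s) (pref y (n (Suc s)))} =
      {y. B s (pref y (n s))} \<union> {y. Q (pref y (g N))}"
    by (auto simp: B_Suc)
  then have "measure lam {y. B (Suc s) (pref y (n (Suc s)))} \<le>
      measure lam {y. B s (pref y (n s))} + measure lam {y. Q (pref y (g N))}"
    by (simp add: measure_Un_le sets_pref)
  also have "measure lam {y. Q (pref y (g N))} \<le> 2 ^ N / 2 ^ g N"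
  proof -
    have "{v. v < 2 ^ g N \<and> Q v} \<subseteq> \<sigma> N ` {..<2 ^ N}"
      unfolding Q_def using take_bit_less by auto
    then have "card {v. v < 2 ^ g N \<and> Q v} \<le> card (\<sigma> N ` {..<2 ^ N})"
      by (intro card_mono) auto
    also have "\<dots> \<le> 2 ^ N" using card_image_le[of "{..<2 ^ N}" "\<sigma> N"] by simp
    finally have "real (card {v. v < 2 ^ g N \<and> Q v}) \<le> 2 ^ N"
      by (metis of_nat_le_iff of_nat_numeral of_nat_power)
    then show ?thesis unfolding measure_pref by (intro divide_right_mono) auto
  qed
  also have "2 ^ N / 2 ^ g N = (1/2 :: real) ^ (g N - N)"
    using N by (simp add: power_divide power_diff)
  also have "\<dots> \<le> (1/2) ^ (s + 2)" using N by (intro power_decreasing) auto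
  finally show ?thesis by simp
qed

lemma measure_A_bounds:
  "1 - measure lam {y. B s (pref y (n s))} - (1/2) ^ (s + 1) \<le> measure lam A"
  "measure lam A \<le> 1 - measure lam {y. B s (pref y (n s))}"
proof -
  interpret prob_space lam by (rule prob_space_lam)
  define b where "b s = measure lam {y. B s (pref y (n s))}" for s
  have cong: "B s (pref y (n r)) \<longleftrightarrow> B s (pref y (n s))" if "s \<le> r" for s r y
    using n_mono[OF that] by (intro B_cong) (simp add: take_bit_pref min_def)
  have "incseq (\<lambda>s. {y. B s (pref y (n s))})"
  proof (rule incseq_SucI)
    show "{y. B s (pref y (n s))} \<subseteq> {y. B (Suc s) (pref y (n (Suc s)))}" for s
      using cong[of s "Suc s"] by (auto simp: B_Suc)
  qed
  moreover have "(\<Union>s. {y. B s (pref y (n s))}) = - A" by (auto simp: A_def)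
  ultimately have lim: "b \<longlonglongrightarrow> measure lam (- A)" and inc: "incseq b"
    using finite_Lim_measure_incseq[of "\<lambda>s. {y. B s (pref y (n s))}",
        OF image_subsetI[OF sets_pref]] sets_pref
    unfolding b_def[abs_def] by (auto simp: incseq_def intro!: finite_measure_mono)
  have "- A \<in> events"
    using Pi01_A sets_Sigma01_set unfolding Pi01_def Sigma01_def by auto
  then have A: "measure lam A = 1 - measure lam (- A)"
    using prob_compl[of "- A"] by (simp add: Compl_eq_Diff_UNIV[symmetric])
  \<comment> \<open>Subtracting \<open>(1/2) ^ (r + 1)\<close> keeps the exact partial sum of the
    geometric series, so that the induction on \<open>r\<close> closes.\<close>
  have "b r \<le> b s + (1/2) ^ (s + 1) - (1/2) ^ (r + 1)" if "s \<le> r" for r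
    using that
  proof (induction rule: dec_induct)
    case (step r)
    then show ?case using measure_B_Suc[of r] by (simp add: b_def)
  qed simp
  then have "b r \<le> b s + (1/2) ^ (s + 1)" if "s \<le> r" for r
    using that by (smt (verit) zero_le_power divide_nonneg_nonneg)
  then have "measure lam (- A) \<le> b s + (1/2) ^ (s + 1)"
    by (intro LIMSEQ_le_const2[OF lim]) blast
  then show "1 - measure lam {y. B s (pref y (n s))} - (1/2) ^ (s + 1) \<le> measure lam A"
    unfolding A b_def by simp
  show "measure lam A \<le> 1 - measure lam {y. B s (pref y (n s))}"
    using incseq_le[OF inc lim, of s] unfolding A b_def by simp
qed

text \<open>Before stage 0 nothing is removed, so the lower bound there is 1/2.\<close>

lemma measure_A_pos: "0 < measure lam A"
  using measure_A_bounds(1)[of 0] by (simp add: B_def)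

lemma computable_real_measure_A: "computable_real (measure lam A)"
proof -
  define c where "c s = (\<Sum>v<2 ^ n s. of_bool (B s v) :: nat)" for s
  \<comment> \<open>The factor 2 codes a nonnegative integer for \<open>int_decode\<close>, and
    denominators are coded by their predecessors.\<close>
  define q where "q s = prod_encode (2 * (2 ^ n s - c s), 2 ^ n s - 1)" for s
  have "computable c"
    unfolding c_def
    by (intro computable_intros computable_compose[OF computable_n])
      (simp only: computable2_def, intro computable_intros)
  then have "computable q"
    unfolding q_def
    by (intro computable_intros computable_compose[OF computable_n] computable_compose[OF \<open>computable c\<close>])
  moreover have "\<bar>rat_of_code (q s) - measure lam A\<bar> \<le> (1/2) ^ s" for s
  proof -
    have B: "measure lam {y. B s (pref y (n s))} = c s / 2 ^ n s"
      by (simp add: measure_pref c_def sum_of_bool_eq Int_def)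
    have "c s \<le> (\<Sum>v<(2 :: nat) ^ n s. 1)" unfolding c_def by (intro sum_mono) auto
    then have "c s \<le> 2 ^ n s" by simp
    then have "rat_of_code (q s) = 1 - c s / 2 ^ n s"
      by (simp add: q_def rat_of_code_def int_decode_def sum_decode_def of_nat_diff diff_divide_distrib)
    moreover have "(1/2 :: real) ^ (s + 1) \<le> (1/2) ^ s" by simp
    ultimately show ?thesis using measure_A_bounds[of s] unfolding B by linarith
  qed
  ultimately show ?thesis by (rule computable_realI)
qed

section \<open>The cycle of the initial segment of \<open>x\<close>\<close>

text \<open>
  The condition is on all \<open>u\<close> that extend the initial segment of \<open>x\<close>, and not just on that
  segment, because the induction on \<open>s\<close> looks at the cycles of longer strings.
\<close>

definition cycle :: "cantor \<Rightarrow> nat \<Rightarrow> nat \<Rightarrow> bool" where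
  "cycle x s p \<longleftrightarrow> 0 < p \<and> (\<forall>u. take_bit (n s) u = pref x (n s) \<longrightarrow>
     (T s ^^ p) u = u \<and> (\<forall>k. 0 < k \<longrightarrow> k < p \<longrightarrow> B s ((T s ^^ k) u)))"

text \<open>Strictly between times 0 and \<open>p\<close> the orbit runs through \<open>B s\<close>,
  where \<open>P s\<close> is the identity; the new involution first acts when the orbit is back at
  \<open>u\<close>.\<close>

lemma T_Suc_orbit:
  assumes "cycle x s p" "take_bit (n s) u = pref x (n s)"
  shows "k < p \<Longrightarrow> (T (Suc s) ^^ k) u = (T s ^^ k) u" "(T (Suc s) ^^ p) u = P s u"
proof -
  have less: "k < p \<Longrightarrow> (T (Suc s) ^^ k) u = (T s ^^ k) u" for k
  proof (induction k)
    case (Suc k)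
    then have "B s ((T s ^^ Suc k) u)" using assms unfolding cycle_def by blast
    then have "P s ((T s ^^ Suc k) u) = (T s ^^ Suc k) u"
      by (intro P_fixes) (auto simp: source_def B_Suc)
    then show ?case using Suc by simp
  qed simp
  then show "k < p \<Longrightarrow> (T (Suc s) ^^ k) u = (T s ^^ k) u" .
  obtain k where p: "p = Suc k" using assms(1) unfolding cycle_def by (cases p) auto
  have "(T (Suc s) ^^ p) u = P s ((T s ^^ p) u)" using less[of k] by (simp add: p)
  then show "(T (Suc s) ^^ p) u = P s u" using assms unfolding cycle_def by simp
qed

lemma cycle_0: "cycle x 0 1"
  by (simp add: cycle_def)

lemma cycle_Suc_same:
  assumes "cycle x s p" "\<And>u. take_bit (n (Suc s)) u = pref x (n (Suc s)) \<Longrightarrow> P s u = u"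
  shows "cycle x (Suc s) p"
  unfolding cycle_def
proof (intro conjI allI impI)
  fix u assume u: "take_bit (n (Suc s)) u = pref x (n (Suc s))"
  then have u': "take_bit (n s) u = pref x (n s)"
    using take_bit_coarsen[of "n (Suc s)" u "pref x (n (Suc s))" "n s"] n_less[of s]
    by (simp add: take_bit_pref min_def)
  show "(T (Suc s) ^^ p) u = u" using T_Suc_orbit(2)[OF assms(1) u'] assms(2)[OF u] by simp
  show "B (Suc s) ((T (Suc s) ^^ k) u)" if "0 < k" "k < p" for k
    using assms(1) u' that T_Suc_orbit(1)[OF assms(1) u'] unfolding cycle_def B_Suc by simp
qed (use assms(1) in \<open>simp add: cycle_def\<close>)

text \<open>The point \<open>z = P s u\<close> has the same first \<open>n s\<close> bits as
  \<open>u\<close>, so under \<open>T s\<close> it also returns after \<open>p\<close> steps. The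
  involution redirects each return to the other point and thus joins the two cycles; the new
  intermediate point \<open>z\<close> lies in \<open>target s\<close>, hence outside
  \<open>A\<close>.\<close>

lemma cycle_Suc_double:
  assumes "cycle x s p" "\<And>u. take_bit (n (Suc s)) u = pref x (n (Suc s)) \<Longrightarrow> source s u"
  shows "cycle x (Suc s) (p + p)"
  unfolding cycle_def
proof (intro conjI allI impI)
  fix u assume u: "take_bit (n (Suc s)) u = pref x (n (Suc s))"
  then have u': "take_bit (n s) u = pref x (n s)"
    using take_bit_coarsen[of "n (Suc s)" u "pref x (n (Suc s))" "n s"] n_less[of s]
    by (simp add: take_bit_pref min_def)
  define z where "z = P s u"
  have z': "take_bit (n s) z = pref x (n s)" using u' by (simp add: z_def take_bit_n_P)
  have uz: "(T (Suc s) ^^ p) u = z" using T_Suc_orbit(2)[OF assms(1) u'] by (simp add: z_def)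
  have zu: "(T (Suc s) ^^ p) z = u" using T_Suc_orbit(2)[OF assms(1) z'] by (simp add: z_def P_P)
  show "(T (Suc s) ^^ (p + p)) u = u" by (simp add: funpow_add uz zu)
  show "B (Suc s) ((T (Suc s) ^^ k) u)" if k: "0 < k" "k < p + p" for k
  proof -
    consider "k < p" | "k = p" | j where "k = j + p" "0 < j" "j < p"
      using k by (metis add.commute add_less_cancel_left less_imp_add_positive linorder_neqE_nat)
    then show ?thesis
    proof cases
      case 1
      then show ?thesis
        using assms(1) u' k(1) T_Suc_orbit(1)[OF assms(1) u'] unfolding cycle_def B_Suc by simp
    next
      case 2
      then show ?thesis using target_P[OF assms(2)[OF u]] uz by (simp add: B_Suc z_def)
    next
      case 3
      then have "B s ((T (Suc s) ^^ j) z)"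
        using assms(1) z' T_Suc_orbit(1)[OF assms(1) z'] unfolding cycle_def by simp
      then show ?thesis using 3(1) by (simp add: funpow_add uz B_Suc)
    qed
  qed
qed (use assms(1) in \<open>simp add: cycle_def\<close>)

context
  fixes x :: cantor
  assumes avoids: "\<And>m. pref x (g m) \<noteq> \<sigma> m (pref x m)"
    and infinitely_often: "\<And>J. \<exists>s\<ge>J. V s (pref x (n (Suc s)))"
begin

lemma not_target: "take_bit (n (Suc s)) u = pref x (n (Suc s)) \<Longrightarrow> \<not> target s u"
  using target_cong[of s u "pref x (n (Suc s))"] avoids[of "n s"] g_le[of s] n_less[of s]
  by (simp add: target_def take_bit_pref min_def)

lemma not_B:
  assumes "take_bit (n s) u = pref x (n s)"
  shows "\<not> B s u"
proof -
  have "\<not> target i u" if "i < s" for i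
  proof (rule not_target)
    have "n (Suc i) \<le> n s" using that by (intro n_mono) simp
    then show "take_bit (n (Suc i)) u = pref x (n (Suc i))"
      using take_bit_coarsen[of "n s" u "pref x (n s)"] assms by (simp add: take_bit_pref min_def)
  qed
  then show ?thesis by (auto simp: B_def)
qed

lemma mem_A: "x \<in> A"
  unfolding A_def using not_B by (simp add: take_bit_pref)

lemma cycle_Suc:
  assumes "cycle x s p"
  shows "cycle x (Suc s) (if V s (pref x (n (Suc s))) then p + p else p)"
proof (cases "V s (pref x (n (Suc s)))")
  case True
  then show ?thesis using cycle_Suc_double[OF assms] not_B[of "Suc s"] by (simp add: source_def)
next
  case False
  then show ?thesis
    using cycle_Suc_same[OF assms] P_fixes[of s] not_target by (simp add: source_def)
qed

lemma cycle_later: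
  assumes "cycle x s p" "s \<le> r"
  shows "\<exists>p'\<ge>p. cycle x r p'"
  using assms(2)
proof (induction rule: dec_induct)
  case base
  then show ?case using assms(1) by blast
next
  case (step r)
  then obtain p' where "p \<le> p'" "cycle x r p'" by blast
  then show ?case using cycle_Suc[of r p'] by (metis trans_le_add1)
qed

lemma cycle_unbounded: "\<exists>s p. K < p \<and> cycle x s p"
proof (induction K)
  case 0
  then show ?case using cycle_0 by blast
next
  case (Suc K)
  then obtain s p where sp: "K < p" "cycle x s p" by blast
  obtain r where r: "s \<le> r" "V r (pref x (n (Suc r)))" using infinitely_often by blast
  from cycle_later[OF sp(2) r(1)] obtain p' where p': "p \<le> p'" "cycle x r p'" by blast
  then have "cycle x (Suc r) (p' + p')" using cycle_Suc[of r p'] r(2) by simp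
  moreover have "Suc K < p' + p'" using sp(1) p'(1) by linarith
  ultimately show ?case by blast
qed

text \<open>For a given \<open>k\<close>, a single stage whose cycle is longer than \<open>k\<close>
  decides the matter, since the limit acts like \<open>T s\<close> on the first \<open>n s\<close>
  bits.\<close>

lemma orbit_avoids_A:
  assumes "0 < k"
  shows "(T_lim ^^ k) x \<notin> A"
proof -
  obtain s p where "k < p" "cycle x s p" using cycle_unbounded by blast
  then have "B s ((T s ^^ k) (pref x (n s)))"
    using assms unfolding cycle_def by (simp add: take_bit_pref)
  then show ?thesis by (auto simp: A_def pref_T_lim_funpow)
qed

end

end

theorem theorem3p34:
  fixes x :: cantor
  assumes "\<not> schnorr_random x" and "\<not> weakly_1_generic x"
  shows "\<exists>A T. Pi01 A \<and> x \<in> A \<and> measure lam A > 0 \<and> computable_real (measure lam A) \<and>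
           computable_map T \<and> measure_preserving_map T \<and>
           (\<forall>k>0. (T ^^ k) x \<notin> A)"
proof -
  obtain g \<sigma> where g: "computable g" "computable2 \<sigma>" "\<And>n. 2 * n + 2 \<le> g n"
    "\<And>n \<tau>. \<tau> < 2 ^ n \<Longrightarrow> \<sigma> n \<tau> < 2 ^ g n" "\<And>n \<tau>. \<tau> < 2 ^ n \<Longrightarrow> \<sigma> n \<tau> mod 2 ^ n = \<tau>"
    and avoids: "\<And>n. pref x (g n) \<noteq> \<sigma> n (pref x n)"
    using computable_extension_of_not_weakly_1_generic[OF assms(2)] by blast
  obtain n V where V: "computable n" "decidable2 V" "\<And>s. n s < n (Suc s)"
    "\<And>s. g (n s) \<le> n (Suc s)"
    "\<And>s. card {w. w < 2 ^ n (Suc s) \<and> V s w} * 2 ^ g (n s) \<le> 2 ^ n (Suc s)"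
    and io: "\<And>J. \<exists>s\<ge>J. V s (pref x (n (Suc s)))"
    using clopen_sequence_of_not_schnorr_random[OF assms(1) g(1)] by blast
  interpret swap_construction g n \<sigma> V
    using g V by unfold_locales auto
  show ?thesis
    by (intro exI[of _ A] exI[of _ T_lim] conjI allI impI Pi01_A mem_A[OF avoids io] measure_A_pos
        computable_real_measure_A computable_T_lim measure_preserving_T_lim
        orbit_avoids_A[OF avoids io])
qed

end
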